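(* The following evaluations hold: (i) $\dfrac{\psi(-e^{-\pi/\sqrt5})}{e^{-\pi/(2\sqrt5)}\psi(-e^{-\sqrt5\pi})}=5^{1/4}$; (ii) $\dfrac{\psi(-e^{-3\pi/\sqrt5})}{e^{-3\pi/(2\sqrt5)}\psi(-e^{-3\sqrt5\pi})}=\dfrac{5^{1/4}(\sqrt3+1)(\sqrt5+\sqrt3)}{2}$; (iii) $\dfrac{\psi(-e^{-\pi/(3\sqrt5)})}{e^{-\pi/(3\sqrt5)}\psi(-e^{-3\pi/\sqrt5})}=\dfrac{\sqrt3(\sqrt3-1)(\sqrt5-\sqrt3)}{2}$; (iv) $\dfrac{\psi(-e^{-\pi/(3\sqrt3)})}{e^{-\pi/(12\sqrt3)}\psi(-e^{-\pi/\sqrt3})}=3^{-1/4}(\sqrt[3]4-1)$; (v) $\dfrac{\psi(-e^{-\pi})}{e^{-\pi/4}\psi(-e^{-3\pi})}=\sqrt[4]{3\sqrt3(2+\sqrt3)}$; (vi) $\dfrac{\psi(-e^{-\pi/(3\sqrt5)})}{e^{-\pi/(6\sqrt5)}\psi(-e^{-\sqrt5\pi/3})}=\dfrac{5^{1/4}(\sqrt3-1)(\sqrt5-\sqrt3)}{2}$; (vii) $\dfrac{\psi(-e^{-\sqrt5\pi/3})}{e^{-\sqrt5\pi/3}\psi(-e^{-3\sqrt5\pi})}=\dfrac{\sqrt3(\sqrt3+1)(\sqrt5+\sqrt3)}{2}$; (viii) $\dfrac{\psi(-e^{-\pi/\sqrt3})}{e^{-\pi/(4\sqrt3)}\psi(-e^{-\sqrt3\pi})}=3^{1/4}$;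 (ix) $\dfrac{\psi(-e^{-\sqrt3\pi})}{e^{-\sqrt3\pi/4}\psi(-e^{-3\sqrt3\pi})}=\dfrac{27^{1/4}}{\sqrt[3]4-1}$; (x) $\dfrac{\psi(-e^{-\pi/3})}{e^{-\pi/3}\psi(-e^{-3\pi})}=\sqrt3$; (xi) $\dfrac{\psi(-e^{-\pi/3})}{e^{-\pi/12}\psi(-e^{-\pi})}=\sqrt[4]{\sqrt3(2-\sqrt3)}$; (xii) $\dfrac{\psi(-e^{-\pi/\sqrt3})}{e^{-\pi/\sqrt3}\psi(-e^{-3\sqrt3\pi})}=\dfrac{3}{\sqrt[3]4-1}$; (xiii) $\dfrac{\psi(-e^{-\pi/(3\sqrt3)})}{e^{-\pi/(3\sqrt3)}\psi(-e^{-\sqrt3\pi})}=\sqrt[3]4-1$.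
   Context: For $|q|<1$, $\psi(q)=\sum_{n=0}^{\infty}q^{n(n+1)/2}$. All roots are positive real roots. *)

theory Defs
  imports Complex_Main
begin

definition psi :: "real \<Rightarrow> real" where
  "psi q = (\<Sum>n. q ^ (n * (n + 1) div 2))"

end

theory Submission
  imports "HOL-Probability.Probability" Defs
begin

text \<open>
  Put \<open>F x = exp (- pi * x / 8) * psi (- exp (- pi * x))\<close>. All thirteen values are quotients
  \<open>F a / F b\<close>. The functions \<open>F\<close> and \<open>\<theta> x = (\<Sum>n. exp (- pi * x * n ^ 2))\<close> satisfy the inversion
  formulas \<open>F (1 / x) = sqrt x * F x\<close> and \<open>\<theta> (1 / x) = sqrt x * \<theta> x\<close>; the latter follows from
  monotonicity of the arithmetic-geometric mean, the doubling relations of theta functions, and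
  the Gaussian integral. Reindexing lattice sums gives three further identities:
  \<open>(F x + F (9 * x)) * (\<theta> x - \<theta> (9 * x)) = 2 * F (9 * x) * \<theta> (9 * x)\<close>,
  \<open>(F x + F (9 * x)) ^ 3 * F (9 * x) = F (3 * x) ^ 4 + F (9 * x) ^ 4\<close>, and, with
  \<open>k = \<theta> (3 * x) * \<theta> (5 * x) / (\<theta> x * \<theta> (15 * x))\<close>,
  \<open>F (3 * x) * F (5 * x) / (F x * F (15 * x)) = (1 + k) / (1 - k)\<close>. At \<open>x = 1 / 3\<close> and
  \<open>x = 1 / sqrt 3\<close> the cubic identity together with inversion is a polynomial equation for the
  wanted quotient. At \<open>x = 1 / sqrt 5\<close> the last identity and the first one at \<open>sqrt 5 / 3\<close> give
  two equations for \<open>F (sqrt 5 / 3) / F (3 * sqrt 5)\<close> and the same quotient of \<open>\<theta>\<close>.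
\<close>

section \<open>Lattice sums\<close>

text \<open>The factor \<open>exp (- pi * x / 8)\<close> completes the square: 8 times a triangular
  number plus 1 is an odd square. So \<open>F\<close> is a theta series with a character modulo 8,
  and products of theta series become sums over planar lattices, where a linear substitution trades
  one form and one sublattice for another. The forms m^2 + 15 n^2 and 3 m^2 + 5 n^2 are the two
  classes of primitive positive forms of discriminant -60; hence the identities mixing
  \<open>x\<close>, \<open>15 * x\<close> with \<open>3 * x\<close>, \<open>5 * x\<close>. No single
  substitution gives the wanted relation of degree 15: four lattice identities hold between products
  of theta functions at \<open>x\<close>, its multiples and their halves, and the relation is what
  algebraic elimination leaves. The special arguments are those at which inversion identifies values
  occurring in the same identity. For \<open>1 / 3\<close> and \<open>1 / sqrt 3\<close> this leaves
  one unknown quotient. For \<open>1 / sqrt 5\<close> a quotient of \<open>\<theta>\<close> stays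
  unknown as well, so a second relation between \<open>F\<close> and \<open>\<theta>\<close> is
  indispensable.\<close>

lemma summable_on_real_comparison:
  fixes f g :: "'a \<Rightarrow> real"
  assumes "g summable_on A" "\<And>x. x \<in> A \<Longrightarrow> \<bar>f x\<bar> \<le> g x"
  shows "f summable_on A"
proof -
  have "(\<lambda>x. norm (f x)) summable_on A"
    by (rule summable_on_comparison_test[OF assms(1)]) (use assms(2) in simp_all)
  thus ?thesis by (rule abs_summable_summable)
qed

lemma summable_gaussian:
  fixes y :: real and A :: "int set"
  assumes "y > 0"
  shows "(\<lambda>n. exp (- (y * of_int n ^ 2))) summable_on A"
proof -
  define g where "g = (\<lambda>n::int. exp (- y) ^ nat \<bar>n\<bar>)"
  have geo: "(\<lambda>k. exp (- y) ^ k) summable_on (UNIV :: nat set)"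
    using assms by (intro summable_nonneg_imp_summable_on) auto
  have "g summable_on (range int \<union> range (\<lambda>k. - int k))"
  proof (rule summable_on_union)
    show "g summable_on range int"
      using geo by (subst summable_on_reindex) (auto simp: g_def o_def)
    show "g summable_on range (\<lambda>k. - int k)"
      using geo by (subst summable_on_reindex) (auto simp: g_def o_def inj_on_def)
  qed
  moreover have "range int \<union> range (\<lambda>k. - int k) = UNIV"
    by (metis (no_types, lifting) UNIV_eq_I UnI1 UnI2 int_cases2 rangeI)
  ultimately have "g summable_on UNIV"
    by simp
  moreover have "\<bar>exp (- (y * of_int n ^ 2))\<bar> \<le> g n" for n
  proof -
    have "\<bar>n\<bar> \<le> \<bar>n\<bar> * \<bar>n\<bar>"
      by (cases "n = 0") (simp_all add: mult_le_cancel_left1 del: abs_mult_self_eq)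
    hence "\<bar>n\<bar> \<le> n ^ 2"
      by (simp add: power2_eq_square)
    hence "real_of_int \<bar>n\<bar> \<le> of_int (n ^ 2)"
      using of_int_le_iff by blast
    hence "y * real_of_int \<bar>n\<bar> \<le> y * of_int n ^ 2"
      using assms by simp
    moreover have "g n = exp (- (y * of_int \<bar>n\<bar>))"
      by (simp add: g_def exp_of_nat_mult [symmetric] mult.commute)
    ultimately show ?thesis by simp
  qed
  ultimately have "(\<lambda>n. exp (- (y * of_int n ^ 2))) summable_on (UNIV :: int set)"
    by (rule summable_on_real_comparison)
  thus ?thesis
    by (rule summable_on_subset_banach) auto
qed

lemma summable_on_real_product:
  fixes f :: "'a \<Rightarrow> real" and g :: "'b \<Rightarrow> real"
  assumes "f summable_on A" "g summable_on B"
  shows "(\<lambda>(a, b). f a * g b) summable_on A \<times> B"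
proof -
  have f: "(\<lambda>a. norm (f a)) summable_on A" and g: "(\<lambda>b. norm (g b)) summable_on B"
    using assms by (blast intro: summable_on_iff_abs_summable_on_real[THEN iffD1])+
  define G where "G = (\<Sum>\<^sub>\<infinity>b\<in>B. norm (g b))"
  have "G \<ge> 0"
    unfolding G_def by (rule infsum_nonneg) simp
  have eq: "norm (\<Sum>\<^sub>\<infinity>b\<in>B. norm (f a * g b)) = norm (f a) * G" for a
  proof -
    have "(\<Sum>\<^sub>\<infinity>b\<in>B. norm (f a * g b)) = norm (f a) * G"
      unfolding norm_mult G_def by (rule infsum_cmult_right[OF g])
    thus ?thesis
      using \<open>G \<ge> 0\<close> by (simp add: abs_mult)
  qed
  have "(\<lambda>b. norm (f a * g b)) summable_on B" for a
    unfolding norm_mult by (rule summable_on_cmult_right[OF g])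
  moreover have "(\<lambda>a. norm (\<Sum>\<^sub>\<infinity>b\<in>B. norm (f a * g b))) summable_on A"
    unfolding eq by (rule summable_on_cmult_left[OF f])
  ultimately have "(\<lambda>p. norm ((\<lambda>(a, b). f a * g b) p)) summable_on A \<times> B"
    using Infinite_Sum.abs_summable_on_Sigma_iff[where f = "\<lambda>(a, b). f a * g b" and A = A and B = "\<lambda>_. B"] by simp
  thus ?thesis
    by (rule abs_summable_summable)
qed

lemma infsum_real_product:
  fixes f :: "'a \<Rightarrow> real" and g :: "'b \<Rightarrow> real"
  assumes "f summable_on A" "g summable_on B"
  shows "infsum f A * infsum g B = (\<Sum>\<^sub>\<infinity>(a, b)\<in>A \<times> B. f a * g b)"
  using infsum_Sigma'_banach[OF summable_on_real_product[OF assms]]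
  by (simp add: infsum_cmult_right' infsum_cmult_left')

section \<open>Theta sums in one variable and their products as sums over planar lattices\<close>

definition theta_sum :: "(int \<Rightarrow> real) \<Rightarrow> int set \<Rightarrow> real \<Rightarrow> real" where
  "theta_sum c A y = (\<Sum>\<^sub>\<infinity>n\<in>A. c n * exp (- (y * of_int n ^ 2)))"

lemma theta_sum_summable:
  fixes c :: "int \<Rightarrow> real" and y :: real
  assumes "y > 0" "\<And>n. n \<in> A \<Longrightarrow> \<bar>c n\<bar> \<le> 1"
  shows "(\<lambda>n. c n * exp (- (y * of_int n ^ 2))) summable_on A"
proof -
  have "\<bar>c n * exp (- (y * of_int n ^ 2))\<bar> \<le> exp (- (y * of_int n ^ 2))" if "n \<in> A" for n
    using assms(2)[OF that] by (simp add: abs_mult)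
  thus ?thesis
    by (rule summable_on_real_comparison[OF summable_gaussian[OF assms(1)]])
qed

definition gauss2 :: "real \<Rightarrow> real \<Rightarrow> int \<times> int \<Rightarrow> real" where
  "gauss2 y z = (\<lambda>(m, n). exp (- (y * of_int m ^ 2 + z * of_int n ^ 2)))"

lemma gauss2_summable:
  assumes "y > 0" "z > 0"
  shows "gauss2 y z summable_on S"
proof -
  have "gauss2 y z summable_on UNIV \<times> UNIV"
    using summable_on_real_product[OF summable_gaussian[OF assms(1), of UNIV] summable_gaussian[OF assms(2), of UNIV]]
    by (simp add: gauss2_def exp_add [symmetric] split_def)
  thus ?thesis
    by (rule summable_on_subset_banach) auto
qed

lemma weighted_gauss2_summable:
  assumes "y > 0" "z > 0" "\<And>p. p \<in> S \<Longrightarrow> \<bar>c p\<bar> \<le> 1"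
  shows "(\<lambda>p. c p * gauss2 y z p) summable_on S"
proof -
  have nonneg: "gauss2 y z p \<ge> 0" for p
    by (simp add: gauss2_def split_def)
  have "\<bar>c p * gauss2 y z p\<bar> \<le> gauss2 y z p" if "p \<in> S" for p
    using assms(3)[OF that] nonneg[of p] by (simp add: abs_mult mult_left_le_one_le)
  thus ?thesis
    by (rule summable_on_real_comparison[OF gauss2_summable[OF assms(1,2)]])
qed

lemma theta_sum_mult:
  assumes "y > 0" "z > 0" "\<And>n. n \<in> A \<Longrightarrow> \<bar>c n\<bar> \<le> 1" "\<And>n. n \<in> B \<Longrightarrow> \<bar>d n\<bar> \<le> 1"
  shows "theta_sum c A y * theta_sum d B z =
    (\<Sum>\<^sub>\<infinity>p\<in>A \<times> B. c (fst p) * d (snd p) * gauss2 y z p)"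
proof -
  have "(\<lambda>(m, n). (c m * exp (- (y * of_int m ^ 2))) * (d n * exp (- (z * of_int n ^ 2)))) =
        (\<lambda>p. c (fst p) * d (snd p) * gauss2 y z p)"
    unfolding gauss2_def split_def minus_add_distrib exp_add by (simp add: mult_ac)
  thus ?thesis
    unfolding theta_sum_def using infsum_real_product[OF theta_sum_summable theta_sum_summable] assms
    by simp
qed

abbreviation lat :: "(int \<times> int) set \<Rightarrow> real \<Rightarrow> real \<Rightarrow> real" where
  "lat S y z \<equiv> infsum (gauss2 y z) S"

lemma infsum_split:
  fixes f :: "'a \<Rightarrow> real"
  assumes "f summable_on S"
  shows "infsum f S = infsum f (S \<inter> P) + infsum f (S - P)"
proof -
  have "f summable_on S \<inter> P" "f summable_on S - P"
    by (rule summable_on_subset_banach[OF assms], blast)+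
  from infsum_Un_disjoint[OF this] show ?thesis
    by (simp add: Int_Diff_Un Int_Diff_disjoint)
qed

lemma signed_lat_split:
  assumes "y > 0" "z > 0"
    and "\<And>p. p \<in> S \<Longrightarrow> c p = (if p \<in> P then 1 else -1)"
  shows "(\<Sum>\<^sub>\<infinity>p\<in>S. c p * gauss2 y z p) = lat (S \<inter> P) y z - lat (S - P) y z"
proof -
  have "(\<Sum>\<^sub>\<infinity>p\<in>S. c p * gauss2 y z p) =
        (\<Sum>\<^sub>\<infinity>p\<in>S\<inter>P. c p * gauss2 y z p) + (\<Sum>\<^sub>\<infinity>p\<in>S-P. c p * gauss2 y z p)"
    by (rule infsum_split, rule weighted_gauss2_summable) (use assms in auto)
  also have "(\<Sum>\<^sub>\<infinity>p\<in>S\<inter>P. c p * gauss2 y z p) = lat (S \<inter> P) y z"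
    by (rule infsum_cong) (use assms in auto)
  also have "(\<Sum>\<^sub>\<infinity>p\<in>S-P. c p * gauss2 y z p) = (\<Sum>\<^sub>\<infinity>p\<in>S-P. - gauss2 y z p)"
    by (rule infsum_cong) (use assms in auto)
  finally show ?thesis by (simp add: infsum_uminus)
qed

text \<open>The workhorse for comparing lattice sums: a bijection of index sets that carries one
  diagonal quadratic form to the other leaves the Gaussian weights unchanged.\<close>

lemma lat_bij:
  assumes "\<And>p. p \<in> S \<Longrightarrow> j (i p) = p" "\<And>p. p \<in> S \<Longrightarrow> i p \<in> T"
    "\<And>q. q \<in> T \<Longrightarrow> i (j q) = q" "\<And>q. q \<in> T \<Longrightarrow> j q \<in> S"
    "\<And>p. p \<in> S \<Longrightarrow> y * of_int (fst p) ^ 2 + z * of_int (snd p) ^ 2 =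
       y' * of_int (fst (i p)) ^ 2 + z' * of_int (snd (i p)) ^ 2"
  shows "lat S y z = lat T y' z'"
proof (rule infsum_reindex_bij_witness[where i = j and j = i])
  fix p assume "p \<in> S"
  show "gauss2 y' z' (i p) = gauss2 y z p"
    unfolding gauss2_def split_def using assms(5)[OF \<open>p \<in> S\<close>] by (simp only:)
qed (use assms in simp_all)

text \<open>On odd \<open>n\<close> this is the Kronecker symbol (2/n), the even quadratic character
  modulo 8.\<close>

definition chi8 :: "int \<Rightarrow> real" where
  "chi8 n = (if n mod 8 = 1 \<or> n mod 8 = 7 then 1 else -1)"

definition sgn2 :: "int \<Rightarrow> real" where
  "sgn2 n = (if even n then 1 else -1)"

text \<open>\<open>theta2\<close>, \<open>theta3\<close>, \<open>theta4\<close> are the Jacobi theta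
  constants at nome \<open>exp (- pi * x)\<close>. The half-integers of the first are written as
  halves of odd numbers, whence the factor 1/4.\<close>

definition theta2 :: "real \<Rightarrow> real" where
  "theta2 x = theta_sum (\<lambda>_. 1) {n. odd n} (pi * x / 4)"

definition theta3 :: "real \<Rightarrow> real" where
  "theta3 x = theta_sum (\<lambda>_. 1) UNIV (pi * x)"

definition theta4 :: "real \<Rightarrow> real" where
  "theta4 x = theta_sum sgn2 UNIV (pi * x)"

text \<open>The function \<open>F\<close> of the overview. The odd number 2k + 1 has square 8T + 1
  with T the k-th triangular number, its character is the sign (-1)^T, and the halving compensates
  for counting \<open>n\<close> and \<open>- n\<close>.\<close>

definition psiF :: "real \<Rightarrow> real" where
  "psiF x = theta_sum chi8 {n. odd n} (pi * x / 8) / 2"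

lemma abs_chi8 [simp]: "\<bar>chi8 n\<bar> = 1" and abs_sgn2 [simp]: "\<bar>sgn2 n\<bar> = 1"
  by (auto simp: chi8_def sgn2_def)

text \<open>\<open>sgn2 m * sgn2 n\<close> depends only on the parity of \<open>m + n\<close>, so
  both products see the same two halves of the square lattice and differ in one sign.\<close>

lemma full_products:
  assumes "y > 0" "z > 0"
  shows "theta_sum (\<lambda>_. 1) UNIV y * theta_sum (\<lambda>_. 1) UNIV z =
           lat {p. even (fst p + snd p)} y z + lat {p. odd (fst p + snd p)} y z" (is ?A)
    and "theta_sum sgn2 UNIV y * theta_sum sgn2 UNIV z =
           lat {p. even (fst p + snd p)} y z - lat {p. odd (fst p + snd p)} y z" (is ?B)
proof -
  have *: "UNIV - {p::int\<times>int. even (fst p + snd p)} = {p. odd (fst p + snd p)}" by auto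
  have sgn: "sgn2 (fst p) * sgn2 (snd p) = (if p \<in> {p. even (fst p + snd p)} then 1 else -1)" for p
    by (simp add: sgn2_def)
  have "theta_sum (\<lambda>_. 1) UNIV y * theta_sum (\<lambda>_. 1) UNIV z = lat UNIV y z"
    using theta_sum_mult[OF assms, of UNIV "\<lambda>_. 1" UNIV "\<lambda>_. 1"] by simp
  also have "\<dots> = lat (UNIV \<inter> {p. even (fst p + snd p)}) y z + lat (UNIV - {p. even (fst p + snd p)}) y z"
    by (rule infsum_split[OF gauss2_summable[OF assms]])
  finally show ?A
    unfolding * Int_UNIV_left .
  have "theta_sum sgn2 UNIV y * theta_sum sgn2 UNIV z =
      (\<Sum>\<^sub>\<infinity>p\<in>UNIV. sgn2 (fst p) * sgn2 (snd p) * gauss2 y z p)"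
    using theta_sum_mult[OF assms, of UNIV sgn2 UNIV sgn2] by simp
  also have "\<dots> = lat (UNIV \<inter> {p. even (fst p + snd p)}) y z - lat (UNIV - {p. even (fst p + snd p)}) y z"
    by (rule signed_lat_split[OF assms sgn])
  finally show ?B
    unfolding * Int_UNIV_left .
qed

section \<open>Odd pairs sorted by the residue class of their quotient\<close>

definition odd_lat :: "int \<Rightarrow> int \<Rightarrow> (int \<times> int) set" where
  "odd_lat k N = {p. odd (fst p) \<and> odd (snd p) \<and> (fst p - k * snd p) mod N = 0}"

lemma odd_mod_8: "odd (n::int) \<Longrightarrow> n mod 8 = 1 \<or> n mod 8 = 3 \<or> n mod 8 = 5 \<or> n mod 8 = 7"
  by presburger

lemma odd_lat_flip: "lat (odd_lat k N) y z = lat (odd_lat (- k) N) y z"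
  by (rule lat_bij[where i = "\<lambda>p. (fst p, - snd p)" and j = "\<lambda>p. (fst p, - snd p)"])
     (simp_all add: odd_lat_def)

lemma residues_mod_8:
  fixes m n :: int
  assumes "odd m" "odd n"
  obtains r s where "r \<in> {1, 3, 5, 7}" "s \<in> {1, 3, 5, 7}" "m mod 8 = r" "n mod 8 = s"
    "\<And>k. (m - k * n) mod 8 = (r - k * s) mod 8"
proof -
  have *: "(m - k * n) mod 8 = (m mod 8 - k * (n mod 8)) mod 8" for k
  proof -
    have "m - k * n = (8 * (m div 8) + m mod 8) - k * (8 * (n div 8) + n mod 8)"
      by simp
    also have "\<dots> = (m mod 8 - k * (n mod 8)) + 8 * (m div 8 - k * (n div 8))"
      by (simp only: algebra_simps)
    finally show ?thesis
      by (metis mod_mult_self2)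
  qed
  show ?thesis
    by (rule that[OF _ _ refl refl *]) (use odd_mod_8 assms in auto)
qed

lemma chi8_mult_odd:
  assumes "odd m" "odd n"
  shows "chi8 m * chi8 n = (if (m - 1 * n) mod 8 = 0 \<or> (m - (-1) * n) mod 8 = 0 then 1 else -1)"
proof (rule residues_mod_8[OF assms])
  fix r s assume rs: "r \<in> {1, 3, 5, 7::int}" "s \<in> {1, 3, 5, 7::int}" "m mod 8 = r" "n mod 8 = s"
    and *: "\<And>k. (m - k * n) mod 8 = (r - k * s) mod 8"
  show ?thesis
    unfolding chi8_def rs(3,4) * using rs(1,2) by (elim insertE emptyE) simp_all
qed

text \<open>The unit m/n modulo 8 is exactly one of 1, -1, 5, -5.\<close>

lemma odd_pair_cases:
  fixes m n :: int
  assumes "odd m" "odd n"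
  shows "((m - 1 * n) mod 8 = 0) = ((m - (-1) * n) mod 8 \<noteq> 0 \<and> (m - 5 * n) mod 8 \<noteq> 0 \<and> (m - (-5) * n) mod 8 \<noteq> 0)"
    and "((m - (-1) * n) mod 8 = 0) = ((m - 1 * n) mod 8 \<noteq> 0 \<and> (m - 5 * n) mod 8 \<noteq> 0 \<and> (m - (-5) * n) mod 8 \<noteq> 0)"
    and "((m - 5 * n) mod 8 = 0) = ((m - 1 * n) mod 8 \<noteq> 0 \<and> (m - (-1) * n) mod 8 \<noteq> 0 \<and> (m - (-5) * n) mod 8 \<noteq> 0)"
proof -
  obtain r s where rs: "r \<in> {1, 3, 5, 7::int}" "s \<in> {1, 3, 5, 7::int}"
    and *: "\<And>k. (m - k * n) mod 8 = (r - k * s) mod 8"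
    using residues_mod_8[OF assms] by metis
  show "((m - 1 * n) mod 8 = 0) = ((m - (-1) * n) mod 8 \<noteq> 0 \<and> (m - 5 * n) mod 8 \<noteq> 0 \<and> (m - (-5) * n) mod 8 \<noteq> 0)"
    unfolding * using rs by (elim insertE emptyE) simp_all
  show "((m - (-1) * n) mod 8 = 0) = ((m - 1 * n) mod 8 \<noteq> 0 \<and> (m - 5 * n) mod 8 \<noteq> 0 \<and> (m - (-5) * n) mod 8 \<noteq> 0)"
    unfolding * using rs by (elim insertE emptyE) simp_all
  show "((m - 5 * n) mod 8 = 0) = ((m - 1 * n) mod 8 \<noteq> 0 \<and> (m - (-1) * n) mod 8 \<noteq> 0 \<and> (m - (-5) * n) mod 8 \<noteq> 0)"
    unfolding * using rs by (elim insertE emptyE) simp_all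
qed

text \<open>Reflecting one coordinate identifies the classes \<open>k\<close> and
  \<open>- k\<close>, so of the four unit classes modulo 8 only two sums remain. The character is 1
  on the classes of 1 and -1 and is -1 on those of 5 and -5. The classes 1 and 5 together form the
  class 1 modulo 4.\<close>

lemma odd_products:
  assumes "y > 0" "z > 0"
  shows "theta_sum (\<lambda>_. 1) {n. odd n} y * theta_sum (\<lambda>_. 1) {n. odd n} z =
           2 * lat (odd_lat 1 8) y z + 2 * lat (odd_lat 5 8) y z" (is ?A)
    and "theta_sum chi8 {n. odd n} y * theta_sum chi8 {n. odd n} z =
           2 * lat (odd_lat 1 8) y z - 2 * lat (odd_lat 5 8) y z" (is ?B)
    and "lat (odd_lat 1 4) y z = lat (odd_lat 1 8) y z + lat (odd_lat 5 8) y z" (is ?C)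
proof -
  define P where "P = {p::int\<times>int. (fst p - 1 * snd p) mod 8 = 0 \<or> (fst p - (-1) * snd p) mod 8 = 0}"
  let ?S = "{n::int. odd n} \<times> {n::int. odd n}"
  have union: "lat (S \<union> T) y z = lat S y z + lat T y z" if "S \<inter> T = {}" for S T
    using that by (intro infsum_Un_disjoint gauss2_summable assms)
  have cases: "\<not> (odd (fst p) \<and> odd (snd p)) \<or>
    ((p \<in> odd_lat 1 8 \<longleftrightarrow> p \<notin> odd_lat (-1) 8 \<and> p \<notin> odd_lat 5 8 \<and> p \<notin> odd_lat (-5) 8) \<and>
     (p \<in> odd_lat (-1) 8 \<longleftrightarrow> p \<notin> odd_lat 1 8 \<and> p \<notin> odd_lat 5 8 \<and> p \<notin> odd_lat (-5) 8) \<and>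
     (p \<in> odd_lat 5 8 \<longleftrightarrow> p \<notin> odd_lat 1 8 \<and> p \<notin> odd_lat (-1) 8 \<and> p \<notin> odd_lat (-5) 8) \<and>
     (p \<in> P \<longleftrightarrow> p \<in> odd_lat 1 8 \<or> p \<in> odd_lat (-1) 8))" for p
    using odd_pair_cases[of "fst p" "snd p"] unfolding P_def odd_lat_def mem_Collect_eq by argo
  have subs: "p \<in> odd_lat k N \<Longrightarrow> odd (fst p) \<and> odd (snd p)" for p k N by (simp add: odd_lat_def)
  have S: "p \<in> ?S \<longleftrightarrow> odd (fst p) \<and> odd (snd p)" for p by (simp add: mem_Times_iff)
  have 1: "lat (?S \<inter> P) y z = 2 * lat (odd_lat 1 8) y z"
  proof -
    have "?S \<inter> P = odd_lat 1 8 \<union> odd_lat (-1) 8"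
      using cases subs S by blast
    moreover have "odd_lat 1 8 \<inter> odd_lat (-1) 8 = {}"
      using cases subs by blast
    ultimately show ?thesis
      using union odd_lat_flip[where k = 1 and N = 8 and y = y and z = z]
      by simp
  qed
  have 2: "lat (?S - P) y z = 2 * lat (odd_lat 5 8) y z"
  proof -
    have "?S - P = odd_lat 5 8 \<union> odd_lat (-5) 8"
      using cases subs S by blast
    moreover have "odd_lat 5 8 \<inter> odd_lat (-5) 8 = {}"
      using cases subs by blast
    ultimately show ?thesis
      using union odd_lat_flip[where k = 5 and N = 8 and y = y and z = z]
      by simp
  qed
  have "theta_sum (\<lambda>_. 1) {n. odd n} y * theta_sum (\<lambda>_. 1) {n. odd n} z = lat ?S y z"
    using theta_sum_mult[OF assms, of "{n. odd n}" "\<lambda>_. 1" "{n. odd n}" "\<lambda>_. 1"] by simp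
  also have "\<dots> = lat (?S \<inter> P) y z + lat (?S - P) y z"
    by (rule infsum_split[OF gauss2_summable[OF assms]])
  finally show ?A
    unfolding 1 2 .
  have chi: "chi8 (fst p) * chi8 (snd p) = (if p \<in> P then 1 else -1)" if "p \<in> ?S" for p
    using chi8_mult_odd[of "fst p" "snd p"] that unfolding P_def S mem_Collect_eq by simp
  have "theta_sum chi8 {n. odd n} y * theta_sum chi8 {n. odd n} z =
      (\<Sum>\<^sub>\<infinity>p\<in>?S. chi8 (fst p) * chi8 (snd p) * gauss2 y z p)"
    using theta_sum_mult[OF assms, of "{n. odd n}" chi8 "{n. odd n}" chi8] by simp
  also have "\<dots> = lat (?S \<inter> P) y z - lat (?S - P) y z"
    by (rule signed_lat_split[OF assms chi])
  finally show ?B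
    unfolding 1 2 .
  have "(m - n) mod 4 = 0 \<longleftrightarrow> (m - n) mod 8 = 0 \<or> (m - 5 * n) mod 8 = 0" if "odd m" "odd n" for m n :: int
    using that by presburger
  hence "p \<in> odd_lat 1 4 \<longleftrightarrow> p \<in> odd_lat 1 8 \<union> odd_lat 5 8" for p
    unfolding odd_lat_def mem_Collect_eq Un_iff mult_1 by metis
  hence "odd_lat 1 4 = odd_lat 1 8 \<union> odd_lat 5 8"
    by (rule set_eqI)
  moreover have "odd_lat 1 8 \<inter> odd_lat 5 8 = {}"
    using cases subs by blast
  ultimately show ?C
    using union by simp
qed

section \<open>Doubling relations between theta functions\<close>

text \<open>The common real factor \<open>r\<close> is split off so that the comparison of quadratic
  forms becomes an identity between integers.\<close>

lemma lat_bij_form: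
  fixes A B A' B' :: int
  assumes "\<And>s t. (s, t) \<in> S \<Longrightarrow> j (i (s, t)) = (s, t)" "\<And>s t. (s, t) \<in> S \<Longrightarrow> i (s, t) \<in> T"
    "\<And>m n. (m, n) \<in> T \<Longrightarrow> i (j (m, n)) = (m, n)" "\<And>m n. (m, n) \<in> T \<Longrightarrow> j (m, n) \<in> S"
    "\<And>s t. (s, t) \<in> S \<Longrightarrow> A * s ^ 2 + B * t ^ 2 = A' * fst (i (s, t)) ^ 2 + B' * snd (i (s, t)) ^ 2"
    "y = r * of_int A" "z = r * of_int B" "y' = r * of_int A'" "z' = r * of_int B'"
  shows "lat S y z = lat T y' z'"
proof (rule lat_bij[where i = i and j = j])
  fix p assume "p \<in> S"
  hence "real_of_int (A * fst p ^ 2 + B * snd p ^ 2) = of_int (A' * fst (i p) ^ 2 + B' * snd (i p) ^ 2)"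
    using assms(5)[of "fst p" "snd p"] by simp
  hence "r * real_of_int (A * fst p ^ 2 + B * snd p ^ 2) = r * of_int (A' * fst (i p) ^ 2 + B' * snd (i p) ^ 2)"
    by (simp only:)
  thus "y * of_int (fst p) ^ 2 + z * of_int (snd p) ^ 2 = y' * of_int (fst (i p)) ^ 2 + z' * of_int (snd (i p)) ^ 2"
    unfolding assms(6-9) by (simp add: algebra_simps)
qed (use assms(1-4) in auto)

lemma theta_sum_1_mult:
  assumes "y > 0" "z > 0"
  shows "theta_sum (\<lambda>_. 1) A y * theta_sum (\<lambda>_. 1) B z = lat (A \<times> B) y z"
  using theta_sum_mult[OF assms, of A "\<lambda>_. 1" B "\<lambda>_. 1"] by simp

lemma theta_sum_split:
  assumes "y > 0" "\<And>n. n \<in> A \<Longrightarrow> \<bar>c n\<bar> \<le> 1"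
  shows "theta_sum c A y = theta_sum c (A \<inter> P) y + theta_sum c (A - P) y"
  unfolding theta_sum_def by (rule infsum_split, rule theta_sum_summable) (use assms in auto)

lemma theta_sum_scale:
  assumes "k \<noteq> 0"
  shows "theta_sum c {n. k dvd n \<and> P n} y = theta_sum (\<lambda>n. c (k * n)) {n. P (k * n)} (of_int k ^ 2 * y)"
  unfolding theta_sum_def
  by (rule infsum_reindex_bij_witness[where i = "\<lambda>n. k * n" and j = "\<lambda>n. n div k"])
     (use assms in \<open>auto simp: power_mult_distrib mult_ac\<close>)

lemma theta_even_odd:
  assumes "x > 0"
  shows "theta3 x = theta3 (4 * x) + theta2 (4 * x)" "theta4 x = theta3 (4 * x) - theta2 (4 * x)"
proof -
  have even: "theta_sum (\<lambda>_. 1) {n. even n} (pi * x) = theta3 (4 * x)"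
    using theta_sum_scale[of 2 "\<lambda>_. 1" "\<lambda>_. True"] by (simp add: theta3_def mult_ac)
  have odd: "theta_sum (\<lambda>_. 1) {n. odd n} (pi * x) = theta2 (4 * x)"
    by (simp add: theta2_def)
  have diff: "UNIV \<inter> {n. even n} = {n. even n}" "UNIV - {n. even n} = {n::int. odd n}" by auto
  have pos: "pi * x > 0" using assms by simp
  have "theta3 x = theta_sum (\<lambda>_. 1) {n. even n} (pi * x) + theta_sum (\<lambda>_. 1) {n. odd n} (pi * x)"
    unfolding theta3_def using theta_sum_split[OF pos, of UNIV "\<lambda>_. 1" "{n. even n}"]
    unfolding diff by simp
  thus "theta3 x = theta3 (4 * x) + theta2 (4 * x)"
    unfolding even odd .
  have "theta4 x = theta_sum sgn2 {n. even n} (pi * x) + theta_sum sgn2 {n. odd n} (pi * x)"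
    unfolding theta4_def using theta_sum_split[OF pos, of UNIV sgn2 "{n. even n}"]
    unfolding diff by simp
  also have "theta_sum sgn2 {n. even n} (pi * x) = theta_sum (\<lambda>_. 1) {n. even n} (pi * x)"
    unfolding theta_sum_def by (rule infsum_cong) (simp add: sgn2_def)
  also have "theta_sum sgn2 {n. odd n} (pi * x) = (\<Sum>\<^sub>\<infinity>n\<in>{n::int. odd n}. - (1 * exp (- (pi * x * of_int n ^ 2))))"
    unfolding theta_sum_def by (rule infsum_cong) (simp add: sgn2_def)
  also have "\<dots> = - theta_sum (\<lambda>_. 1) {n. odd n} (pi * x)"
    unfolding theta_sum_def by (rule infsum_uminus)
  finally show "theta4 x = theta3 (4 * x) - theta2 (4 * x)"
    unfolding even odd by simp
qed

text \<open>Rotation by 45 degrees: (a + b)^2 + (a - b)^2 = 2 a^2 + 2 b^2. Pairs with even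
  coordinate sum are images of all integer pairs; pairs with odd sum are sent onto the pairs of odd
  numbers.\<close>

lemma theta_squares:
  assumes "x > 0"
  shows "theta3 x ^ 2 + theta4 x ^ 2 = 2 * theta3 (2 * x) ^ 2"
    and "theta3 x ^ 2 - theta4 x ^ 2 = 2 * theta2 (2 * x) ^ 2"
proof -
  have pos: "pi * x > 0" "pi * (2 * x) > 0" "pi * (2 * x) / 4 > 0" using assms by auto
  note prods = full_products[OF pos(1,1), folded theta3_def theta4_def power2_eq_square]
  have "theta3 (2 * x) ^ 2 = lat (UNIV \<times> UNIV) (pi * (2 * x)) (pi * (2 * x))"
    unfolding theta3_def power2_eq_square by (rule theta_sum_1_mult[OF pos(2,2)])
  also have "\<dots> = lat {p. even (fst p + snd p)} (pi * x) (pi * x)"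
    by (rule lat_bij_form[where i = "\<lambda>(a, b). (a + b, a - b)" and j = "\<lambda>(m, n). ((m + n) div 2, (m - n) div 2)"
          and A = 2 and B = 2 and A' = 1 and B' = 1 and r = "pi * x"])
       (auto simp: power2_eq_square algebra_simps; presburger)+
  finally have e: "lat {p. even (fst p + snd p)} (pi * x) (pi * x) = theta3 (2 * x) ^ 2" ..
  have "theta2 (2 * x) ^ 2 = lat ({n. odd n} \<times> {n. odd n}) (pi * (2 * x) / 4) (pi * (2 * x) / 4)"
    unfolding theta2_def power2_eq_square by (rule theta_sum_1_mult[OF pos(3,3)])
  also have "lat {p. odd (fst p + snd p)} (pi * x) (pi * x) = \<dots>"
    by (rule lat_bij_form[where j = "\<lambda>(m, n). ((m + n) div 2, (m - n) div 2)" and i = "\<lambda>(a, b). (a + b, a - b)"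
          and A = 2 and B = 2 and A' = 1 and B' = 1 and r = "pi * x / 2"])
       (auto simp: power2_eq_square algebra_simps; presburger)+
  finally have o: "lat {p. odd (fst p + snd p)} (pi * x) (pi * x) = theta2 (2 * x) ^ 2" by simp
  show "theta3 x ^ 2 + theta4 x ^ 2 = 2 * theta3 (2 * x) ^ 2"
    and "theta3 x ^ 2 - theta4 x ^ 2 = 2 * theta2 (2 * x) ^ 2"
    unfolding prods e o by simp_all
qed

text \<open>With \<open>theta_squares\<close>, passing from \<open>x\<close> to \<open>2 * x\<close>
  becomes one arithmetic-geometric step on the squares of \<open>theta3\<close> and
  \<open>theta4\<close>.\<close>

lemma theta3_times_theta4:
  assumes "x > 0"
  shows "theta3 x * theta4 x = theta4 (2 * x) ^ 2"
proof -
  have "theta3 x * theta4 x = theta3 (4 * x) ^ 2 - theta2 (4 * x) ^ 2"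
    unfolding theta_even_odd[OF assms] by (simp add: power2_eq_square algebra_simps)
  also have "\<dots> = theta4 (2 * x) ^ 2"
    using theta_squares[of "2 * x"] assms by simp
  finally show ?thesis .
qed

text \<open>The dual step: halving \<open>x\<close> acts on the squares of \<open>theta3\<close> and
  \<open>theta2\<close> as an arithmetic-geometric step, up to a factor 2.\<close>

lemma theta2_half_square:
  assumes "x > 0"
  shows "theta2 (x / 2) ^ 2 = 2 * theta2 x * theta3 x"
proof -
  have "2 * theta2 (x / 2) ^ 2 = theta3 (x / 4) ^ 2 - theta4 (x / 4) ^ 2"
    using theta_squares(2)[of "x / 4"] assms by simp
  also have "\<dots> = (theta3 x + theta2 x) ^ 2 - (theta3 x - theta2 x) ^ 2"
    using theta_even_odd[of "x / 4"] assms by simp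
  also have "\<dots> = 4 * theta2 x * theta3 x"
    by (simp add: power2_eq_square algebra_simps)
  finally show ?thesis by simp
qed

text \<open>Jacobi's quartic identity. With A and B the squares of \<open>theta3\<close> and
  \<open>theta4\<close> at \<open>x / 2\<close>, the doubling relations turn it into ((A - B)/2)^2 +
  A B = ((A + B)/2)^2.\<close>

lemma theta_quartic:
  assumes "x > 0"
  shows "theta2 x ^ 4 + theta4 x ^ 4 = theta3 x ^ 4"
proof -
  have sq: "theta2 x ^ 2 = (theta3 (x / 2) ^ 2 - theta4 (x / 2) ^ 2) / 2"
    "theta3 x ^ 2 = (theta3 (x / 2) ^ 2 + theta4 (x / 2) ^ 2) / 2"
    "theta4 x ^ 2 = theta3 (x / 2) * theta4 (x / 2)"
    using theta_squares[of "x / 2"] theta3_times_theta4[of "x / 2"] assms by simp_all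
  have "(theta2 x ^ 2) ^ 2 + (theta4 x ^ 2) ^ 2 = (theta3 x ^ 2) ^ 2"
    unfolding sq by (simp add: power2_eq_square field_simps)
  thus ?thesis
    by simp
qed

text \<open>The substitution m = a + 2b, n = a - 2b with \<open>a\<close> odd gives m - n = 4b. So
  the parity of \<open>b\<close> decides between m = n and m = 5n modulo 8, and
  \<open>sgn2 b\<close> becomes the product of the two characters.\<close>

lemma psiF_square:
  assumes "x > 0"
  shows "2 * psiF x ^ 2 = theta2 x * theta4 x"
proof -
  define y where "y = pi * x / 8"
  have y: "y > 0" "pi * x / 4 > 0" "pi * x > 0" using assms by (auto simp: y_def)
  have 4: "4 * psiF x ^ 2 = 2 * lat (odd_lat 1 8) y y - 2 * lat (odd_lat 5 8) y y"
    using odd_products(2)[OF y(1,1)] by (simp add: psiF_def y_def power2_eq_square)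
  let ?S = "{n::int. odd n} \<times> (UNIV :: int set)"
  have "theta2 x * theta4 x =
     (\<Sum>\<^sub>\<infinity>p\<in>?S. 1 * sgn2 (snd p) * gauss2 (pi * x / 4) (pi * x) p)"
    unfolding theta2_def theta4_def by (rule theta_sum_mult[OF y(2,3)]) auto
  also have "\<dots> = lat (?S \<inter> {p. even (snd p)}) (pi * x / 4) (pi * x) - lat (?S - {p. even (snd p)}) (pi * x / 4) (pi * x)"
    by (rule signed_lat_split[OF y(2,3)]) (auto simp: sgn2_def)
  also have "lat (?S \<inter> {p. even (snd p)}) (pi * x / 4) (pi * x) = lat (odd_lat 1 8) y y"
    by (rule lat_bij_form[where i = "\<lambda>(a, b). (a + 2 * b, a - 2 * b)" and j = "\<lambda>(m, n). ((m + n) div 2, (m - n) div 4)"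
          and A = 2 and B = 8 and A' = 1 and B' = 1 and r = y])
       (auto simp: y_def odd_lat_def power2_eq_square algebra_simps; presburger)+
  also have "lat (?S - {p. even (snd p)}) (pi * x / 4) (pi * x) = lat (odd_lat 5 8) y y"
    by (rule lat_bij_form[where i = "\<lambda>(a, b). (a + 2 * b, a - 2 * b)" and j = "\<lambda>(m, n). ((m + n) div 2, (m - n) div 4)"
          and A = 2 and B = 8 and A' = 1 and B' = 1 and r = y])
       (auto simp: y_def odd_lat_def power2_eq_square algebra_simps; presburger)+
  finally show ?thesis
    using 4 by simp
qed

section \<open>Inversion\<close>

lemma theta_sum_ge_term:
  assumes "y > 0" "n \<in> A"
  shows "exp (- (y * of_int n ^ 2)) \<le> theta_sum (\<lambda>_. 1) A y"
proof -
  have "sum (\<lambda>n. 1 * exp (- (y * of_int n ^ 2))) {n} \<le> theta_sum (\<lambda>_. 1) A y"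
    unfolding theta_sum_def
    by (rule finite_sum_le_infsum, rule theta_sum_summable) (use assms in auto)
  thus ?thesis by simp
qed

lemma theta3_ge_1: "x > 0 \<Longrightarrow> theta3 x \<ge> 1"
  using theta_sum_ge_term[of "pi * x" 0 UNIV] by (simp add: theta3_def)

lemma theta3_pos: "x > 0 \<Longrightarrow> theta3 x > 0"
  using theta3_ge_1[of x] by simp

lemma theta2_pos:
  assumes "x > 0"
  shows "theta2 x > 0"
proof -
  have "exp (- (pi * x / 4 * of_int 1 ^ 2)) \<le> theta2 x"
    unfolding theta2_def by (rule theta_sum_ge_term) (use assms in auto)
  thus ?thesis
    using exp_gt_zero less_le_trans by blast
qed

lemma half_gaussian_integral:
  fixes t :: real
  assumes "t > 0"
  shows "(\<lambda>n. integral {0..real n} (\<lambda>u. exp (- (pi * t * u ^ 2)))) \<longlonglongrightarrow> 1 / (2 * sqrt t)"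
proof -
  \<comment> \<open>Scaling by \<open>c\<close> reduces the claim to the standard half-line Gaussian
    integral, whose value is \<open>sqrt pi / 2\<close>.\<close>
  define c where "c = sqrt (pi * t)"
  have c: "c > 0" "c ^ 2 = pi * t" using assms by (auto simp: c_def)
  define f where "f = (\<lambda>u. exp (- (pi * t * u ^ 2)))"
  have "has_bochner_integral lborel (\<lambda>u. indicator {0..} (0 + c * u) *\<^sub>R exp (- ((0 + c * u) ^ 2))) ((sqrt pi / 2) /\<^sub>R \<bar>c\<bar>)"
    using c lborel_has_bochner_integral_real_affine_iff[of c "\<lambda>x. indicator {0..} x *\<^sub>R exp (- x\<^sup>2)" _ 0] gaussian_moment_0 by simp
  moreover have "(\<lambda>u. indicator {0..} (0 + c * u) *\<^sub>R exp (- ((0 + c * u) ^ 2))) = (\<lambda>u. indicator {0..} u *\<^sub>R f u)"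
    using c by (auto simp: fun_eq_iff f_def indicator_def power_mult_distrib zero_le_mult_iff)
  moreover have "(sqrt pi / 2) /\<^sub>R \<bar>c\<bar> = 1 / (2 * sqrt t)"
    using assms by (simp add: c_def real_sqrt_mult field_simps)
  ultimately have hbi: "has_bochner_integral lborel (\<lambda>u. indicator {0..} u *\<^sub>R f u) (1 / (2 * sqrt t))"
    by (simp only:)
  hence int: "integrable lborel (\<lambda>u. indicator {0..} u *\<^sub>R f u)"
    and val: "(LINT u|lborel. indicator {0..} u *\<^sub>R f u) = 1 / (2 * sqrt t)"
    by (auto simp: has_bochner_integral_iff)
  have "((\<lambda>y. LINT u|lborel. indicator {..y} u *\<^sub>R (indicator {0..} u *\<^sub>R f u)) \<longlongrightarrow> 1 / (2 * sqrt t)) at_top"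
    using tendsto_integral_at_top[OF _ int] val by simp
  hence "(\<lambda>n. LINT u|lborel. indicator {..real n} u *\<^sub>R (indicator {0..} u *\<^sub>R f u)) \<longlonglongrightarrow> 1 / (2 * sqrt t)"
    by (rule filterlim_compose) (rule filterlim_real_sequentially)
  moreover have "(LINT u|lborel. indicator {..real n} u *\<^sub>R (indicator {0..} u *\<^sub>R f u)) = integral {0..real n} f" for n
  proof -
    have eq: "(\<lambda>u. indicator {..real n} u *\<^sub>R (indicator {0..} u *\<^sub>R f u)) = (\<lambda>u. indicator {0..real n} u *\<^sub>R f u)"
      by (auto simp: fun_eq_iff indicator_def)
    have "set_integrable lborel {0..real n} f"
      unfolding f_def by (intro borel_integrable_atLeastAtMost' continuous_intros)
    thus ?thesis
      unfolding eq using set_borel_integral_eq_integral(2)[of "{0..real n}" f]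
      by (simp add: set_lebesgue_integral_def)
  qed
  ultimately show ?thesis by (simp add: f_def)
qed

lemma theta3_nat_sum:
  assumes "x > 0"
  shows "(\<lambda>k. exp (- (pi * x * real k ^ 2))) sums ((theta3 x + 1) / 2)"
proof -
  define g where "g = (\<lambda>n::int. exp (- (pi * x * of_int n ^ 2)))"
  have summ: "g summable_on A" for A
    unfolding g_def by (rule summable_gaussian) (use assms in auto)
  have U: "UNIV = {0::int..} \<union> {..<0}" by auto
  have "theta3 x = infsum g {0..} + infsum g {..<0}"
    using infsum_Un_disjoint[OF summ summ, of "{0..}" "{..<0}"]
    by (simp add: theta3_def theta_sum_def g_def U [symmetric] disjoint_iff)
  moreover have "infsum g {..<0} = infsum g {0<..}"
    by (rule infsum_reindex_bij_witness[where i = uminus and j = uminus]) (auto simp: g_def)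
  moreover have "infsum g {0..} = infsum g {0} + infsum g {0<..}"
  proof -
    have "{0::int..} = {0} \<union> {0<..}" by auto
    thus ?thesis
      using infsum_Un_disjoint[OF summ summ, of "{0}" "{0<..}"] by simp
  qed
  moreover have "infsum g {0} = 1" by (simp add: g_def)
  ultimately have val: "infsum g {0..} = (theta3 x + 1) / 2" by simp
  have "(g has_sum (theta3 x + 1) / 2) {0..}"
    using has_sum_infsum[OF summ] val by metis
  hence "((\<lambda>k. exp (- (pi * x * real k ^ 2))) has_sum ((theta3 x + 1) / 2)) UNIV"
    by (subst has_sum_reindex_bij_witness[where i = nat and j = int and T = "{0..}" and h = g]) (auto simp: g_def)
  thus ?thesis by (rule has_sum_imp_sums)
qed

text \<open>For a decreasing nonnegative function, sum minus integral stays between 0 and the first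
  term, here 1. This crude bound suffices for both limits: \<open>theta3\<close> tends to 1 at
  infinity and grows like \<open>1 / sqrt x\<close> at zero.\<close>

lemma theta3_bounds:
  assumes "x > 0"
  shows "\<bar>theta3 x - 1 / sqrt x\<bar> \<le> 1"
proof -
  define f where "f = (\<lambda>u. exp (- (pi * x * u ^ 2)))"
  interpret antimono_fun_sum_integral_diff f
  proof
    fix u v :: real assume "0 \<le> u" "u \<le> v"
    hence "u ^ 2 \<le> v ^ 2" by (simp add: power_mono)
    thus "f v \<le> f u" using assms by (simp add: f_def)
  qed (auto simp: f_def intro!: continuous_intros)
  have "(\<lambda>n. \<Sum>k\<le>n. f (real k)) \<longlonglongrightarrow> (theta3 x + 1) / 2"
    using theta3_nat_sum[OF assms] unfolding sums_def_le f_def .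
  hence lim: "sum_integral_diff_series \<longlonglongrightarrow> (theta3 x + 1) / 2 - 1 / (2 * sqrt x)"
    unfolding sum_integral_diff_series_def using half_gaussian_integral[OF assms]
    by (auto simp: f_def intro!: tendsto_diff)
  have "f 0 = 1" by (simp add: f_def)
  hence "sum_integral_diff_series 0 = 1"
    by (simp add: sum_integral_diff_series_def)
  hence "sum_integral_diff_series n \<le> 1" for n
    using sum_integral_diff_series_antimono[of 0 n] by simp
  hence "(theta3 x + 1) / 2 - 1 / (2 * sqrt x) \<le> 1"
    by (intro LIMSEQ_le_const2[OF lim]) auto
  moreover have "(theta3 x + 1) / 2 - 1 / (2 * sqrt x) \<ge> 0"
    by (intro LIMSEQ_le_const[OF lim]) (auto simp: sum_integral_diff_series_nonneg)
  ultimately show ?thesis by (simp add: field_simps)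
qed

lemma theta3_tendsto_1:
  assumes "x > 0"
  shows "(\<lambda>n. theta3 (2 ^ n * x)) \<longlonglongrightarrow> 1"
proof (rule tendsto_sandwich)
  show "\<forall>\<^sub>F n in sequentially. 1 \<le> theta3 (2 ^ n * x)"
    using assms by (intro always_eventually allI theta3_ge_1) simp
  show "\<forall>\<^sub>F n in sequentially. theta3 (2 ^ n * x) \<le> 1 + 1 / sqrt (2 ^ n * x)"
  proof (intro always_eventually allI)
    fix n show "theta3 (2 ^ n * x) \<le> 1 + 1 / sqrt (2 ^ n * x)"
      using theta3_bounds[of "2 ^ n * x"] assms by (simp add: abs_le_iff)
  qed
  show "(\<lambda>n. 1 + 1 / sqrt (2 ^ n * x)) \<longlonglongrightarrow> 1"
    using assms by real_asymp
qed simp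

text \<open>As t tends to 0, \<open>sqrt t * theta3 t\<close> tends to 1; square this at t =
  \<open>x / 2 ^ n\<close>. The factor of the inversion formula originates in this limit.\<close>

lemma theta3_scaled_tendsto:
  assumes "x > 0"
  shows "(\<lambda>n. theta3 (x / 2 ^ n) ^ 2 / 2 ^ n) \<longlonglongrightarrow> 1 / x"
proof -
  have "(\<lambda>n. sqrt (x / 2 ^ n) * theta3 (x / 2 ^ n)) \<longlonglongrightarrow> 1"
  proof (rule tendsto_sandwich)
    have bd: "\<bar>sqrt (x / 2 ^ n) * theta3 (x / 2 ^ n) - 1\<bar> \<le> sqrt (x / 2 ^ n)" for n
    proof -
      have pos: "sqrt (x / 2 ^ n) > 0" "x / 2 ^ n > 0" using assms by simp_all
      have "\<bar>sqrt (x / 2 ^ n) * theta3 (x / 2 ^ n) - 1\<bar> = \<bar>sqrt (x / 2 ^ n) * (theta3 (x / 2 ^ n) - 1 / sqrt (x / 2 ^ n))\<bar>"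
        using assms by (simp add: right_diff_distrib)
      also have "\<dots> = sqrt (x / 2 ^ n) * \<bar>theta3 (x / 2 ^ n) - 1 / sqrt (x / 2 ^ n)\<bar>"
        using pos by (simp only: abs_mult abs_of_pos)
      also have "\<dots> \<le> sqrt (x / 2 ^ n) * 1"
        using theta3_bounds[OF pos(2)] pos(1) by (intro mult_left_mono) auto
      finally show ?thesis by simp
    qed
    show "\<forall>\<^sub>F n in sequentially. 1 - sqrt (x / 2 ^ n) \<le> sqrt (x / 2 ^ n) * theta3 (x / 2 ^ n)"
    proof (intro always_eventually allI)
      fix n show "1 - sqrt (x / 2 ^ n) \<le> sqrt (x / 2 ^ n) * theta3 (x / 2 ^ n)"
        using bd[of n] by linarith
    qed
    show "\<forall>\<^sub>F n in sequentially. sqrt (x / 2 ^ n) * theta3 (x / 2 ^ n) \<le> 1 + sqrt (x / 2 ^ n)"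
    proof (intro always_eventually allI)
      fix n show "sqrt (x / 2 ^ n) * theta3 (x / 2 ^ n) \<le> 1 + sqrt (x / 2 ^ n)"
        using bd[of n] by linarith
    qed
    show "(\<lambda>n. 1 - sqrt (x / 2 ^ n)) \<longlonglongrightarrow> 1" "(\<lambda>n. 1 + sqrt (x / 2 ^ n)) \<longlonglongrightarrow> 1"
      using assms by real_asymp+
  qed
  hence "(\<lambda>n. (sqrt (x / 2 ^ n) * theta3 (x / 2 ^ n)) ^ 2 / x) \<longlonglongrightarrow> 1 ^ 2 / x"
    by (intro tendsto_intros) (use assms in auto)
  thus ?thesis
    using assms by (simp add: power_mult_distrib)
qed

section \<open>The arithmetic-geometric mean of 1 and \<open>c\<close>, run in both directions along
  the doubling relations\<close>

definition agm_limit :: "real \<Rightarrow> real \<Rightarrow> bool" where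
  "agm_limit c L \<longleftrightarrow> (\<exists>a b. a 0 = 1 \<and> b 0 = c \<and> a \<longlonglongrightarrow> L \<and>
     (\<forall>n. a n \<ge> 0 \<and> b n \<ge> 0 \<and> a (Suc n) = (a n + b n) / 2 \<and> b (Suc n) = sqrt (a n * b n)))"

text \<open>Arithmetic and geometric means are monotone in both entries, so the order of the
  starting values persists at every step and in the limit.\<close>

lemma agm_limit_mono:
  assumes "agm_limit c L" "agm_limit c' L'" "c \<le> c'"
  shows "L \<le> L'"
proof -
  obtain a b where ab: "a 0 = 1" "b 0 = c" "a \<longlonglongrightarrow> L"
    and step: "\<forall>n. a n \<ge> 0 \<and> b n \<ge> 0 \<and> a (Suc n) = (a n + b n) / 2 \<and> b (Suc n) = sqrt (a n * b n)"
    using assms(1) unfolding agm_limit_def by (elim exE conjE)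
  obtain a' b' where ab': "a' 0 = 1" "b' 0 = c'" "a' \<longlonglongrightarrow> L'"
    and step': "\<forall>n. a' n \<ge> 0 \<and> b' n \<ge> 0 \<and> a' (Suc n) = (a' n + b' n) / 2 \<and> b' (Suc n) = sqrt (a' n * b' n)"
    using assms(2) unfolding agm_limit_def by (elim exE conjE)
  have "a n \<le> a' n \<and> b n \<le> b' n" for n
  proof (induction n)
    case 0
    thus ?case using ab ab' assms by simp
  next
    case (Suc n)
    have "a n * b n \<le> a' n * b' n"
      using Suc step step' by (intro mult_mono) auto
    thus ?case
      using Suc step[THEN spec, of n] step'[THEN spec, of n] by simp
  qed
  thus ?thesis
    by (intro LIMSEQ_le[OF ab(3) ab'(3)] exI[of _ 0] allI impI) simp
qed

text \<open>The iteration is homogeneous; dividing by \<open>theta3 x ^ 2\<close> makes the first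
  entry start at 1, and the limit is the value at infinity divided by the same constant.\<close>

lemma agm_limit_theta4:
  assumes "x > 0"
  shows "agm_limit (theta4 x ^ 2 / theta3 x ^ 2) (1 / theta3 x ^ 2)"
proof -
  define a where "a = (\<lambda>n. theta3 (2 ^ n * x) ^ 2 / theta3 x ^ 2)"
  define b where "b = (\<lambda>n. theta4 (2 ^ n * x) ^ 2 / theta3 x ^ 2)"
  have "a \<longlonglongrightarrow> 1 ^ 2 / theta3 x ^ 2"
    unfolding a_def using theta3_tendsto_1[OF assms] theta3_pos[OF assms]
    by (intro tendsto_intros) auto
  moreover have "a (Suc n) = (a n + b n) / 2" "b (Suc n) = sqrt (a n * b n)" for n
  proof -
    have pos: "2 ^ n * x > 0" using assms by simp
    have dbl: "2 ^ Suc n * x = 2 * (2 ^ n * x)" by simp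
    have "theta3 (2 ^ Suc n * x) ^ 2 = (theta3 (2 ^ n * x) ^ 2 + theta4 (2 ^ n * x) ^ 2) / 2"
      unfolding dbl using theta_squares(1)[OF pos] by simp
    thus "a (Suc n) = (a n + b n) / 2"
      by (simp add: a_def b_def add_divide_distrib)
    have "theta4 (2 ^ Suc n * x) ^ 2 = theta3 (2 ^ n * x) * theta4 (2 ^ n * x)"
      unfolding dbl theta3_times_theta4[OF pos] ..
    hence "b (Suc n) ^ 2 = a n * b n"
      by (simp add: a_def b_def power_divide power_mult_distrib)
    moreover have "b (Suc n) \<ge> 0"
      by (simp add: b_def)
    ultimately show "b (Suc n) = sqrt (a n * b n)"
      by (metis real_sqrt_unique)
  qed
  ultimately show ?thesis
    unfolding agm_limit_def using theta3_pos[OF assms]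
    by (intro exI[of _ a] exI[of _ b]) (auto simp: a_def b_def)
qed

lemma agm_limit_theta2:
  assumes "x > 0"
  shows "agm_limit (theta2 x ^ 2 / theta3 x ^ 2) (1 / (x * theta3 x ^ 2))"
proof -
  \<comment> \<open>Halving the argument gives a sum of squares and twice a product; the power of 2
    turns these into the arithmetic and the geometric mean.\<close>
  define a where "a = (\<lambda>n. theta3 (x / 2 ^ n) ^ 2 / 2 ^ n / theta3 x ^ 2)"
  define b where "b = (\<lambda>n. theta2 (x / 2 ^ n) ^ 2 / 2 ^ n / theta3 x ^ 2)"
  have "a \<longlonglongrightarrow> 1 / x / theta3 x ^ 2"
    unfolding a_def by (rule tendsto_divide[OF theta3_scaled_tendsto[OF assms] tendsto_const])
      (use theta3_pos[OF assms] in simp)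
  moreover have "a (Suc n) = (a n + b n) / 2" "b (Suc n) = sqrt (a n * b n)" for n
  proof -
    have pos: "x / 2 ^ n > 0" "x / 2 ^ Suc n > 0" using assms by simp_all
    have half: "2 * (x / 2 ^ Suc n) = x / 2 ^ n" "x / 2 ^ n / 2 = x / 2 ^ Suc n" by simp_all
    have "theta3 (x / 2 ^ Suc n) ^ 2 = theta3 (x / 2 ^ n) ^ 2 + theta2 (x / 2 ^ n) ^ 2"
      using theta_squares[OF pos(2)] unfolding half by simp
    thus "a (Suc n) = (a n + b n) / 2"
      by (simp add: a_def b_def add_divide_distrib)
    have "theta2 (x / 2 ^ Suc n) ^ 2 = 2 * theta2 (x / 2 ^ n) * theta3 (x / 2 ^ n)"
      using theta2_half_square[OF pos(1)] unfolding half .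
    hence "b (Suc n) = theta2 (x / 2 ^ n) * theta3 (x / 2 ^ n) / 2 ^ n / theta3 x ^ 2"
      by (simp add: b_def)
    hence "b (Suc n) ^ 2 = a n * b n"
      by (simp add: a_def b_def power2_eq_square)
    moreover have "b (Suc n) \<ge> 0"
      by (simp add: b_def)
    ultimately show "b (Suc n) = sqrt (a n * b n)"
      by (metis real_sqrt_unique)
  qed
  ultimately show ?thesis
    unfolding agm_limit_def using theta3_pos[OF assms]
    by (intro exI[of _ a] exI[of _ b]) (auto simp: a_def b_def field_simps)
qed

text \<open>
  Both \<open>theta4 x ^ 2 / theta3 x ^ 2\<close> and \<open>theta2 (1 / x) ^ 2 / theta3 (1 / x) ^ 2\<close> start
  arithmetic-geometric iterations with known limits. Whichever of the two is larger, the
  complementary moduli are ordered the other way, so monotonicity of the iteration bounds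
  \<open>theta3 (1 / x) ^ 2 / theta3 x ^ 2\<close> by \<open>x\<close> from both sides.
\<close>

lemma theta3_inversion:
  assumes "x > 0"
  shows "theta3 (1 / x) = sqrt x * theta3 x"
proof -
  define y where "y = 1 / x"
  have y: "y > 0" using assms by (simp add: y_def)
  note pos = theta3_pos[OF assms] theta3_pos[OF y]
  have compl: "(theta2 t ^ 2 / theta3 t ^ 2) ^ 2 + (theta4 t ^ 2 / theta3 t ^ 2) ^ 2 = 1" if "t > 0" for t
    using theta_quartic[OF that] theta3_pos[OF that] by (simp add: power_divide add_divide_distrib [symmetric])
  define k where "k = theta2 x ^ 2 / theta3 x ^ 2"
  define k' where "k' = theta4 x ^ 2 / theta3 x ^ 2"
  define l where "l = theta2 y ^ 2 / theta3 y ^ 2"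
  define l' where "l' = theta4 y ^ 2 / theta3 y ^ 2"
  have nonneg: "k \<ge> 0" "k' \<ge> 0" "l \<ge> 0" "l' \<ge> 0"
    by (simp_all add: k_def k'_def l_def l'_def)
  have sq: "k ^ 2 = 1 - k' ^ 2" "l ^ 2 = 1 - l' ^ 2"
    using compl[OF assms] compl[OF y] by (simp_all add: k_def k'_def l_def l'_def)
  have agm: "agm_limit k (1 / (x * theta3 x ^ 2))" "agm_limit k' (1 / theta3 x ^ 2)"
    "agm_limit l (1 / (y * theta3 y ^ 2))" "agm_limit l' (1 / theta3 y ^ 2)"
    unfolding k_def k'_def l_def l'_def
    by (intro agm_limit_theta2 agm_limit_theta4 assms y)+
  have dual: "k \<le> l' \<longleftrightarrow> l \<le> k'"
    using power_mono_iff[OF nonneg(1,4), of 2] power_mono_iff[OF nonneg(3,2), of 2] sq by linarith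
  have inv: "p \<le> q" if "1 / q \<le> 1 / p" "p > 0" "q > 0" for p q :: real
    using that by (simp add: field_simps)
  have sqpos: "theta3 x ^ 2 > 0" "theta3 y ^ 2 > 0"
    using pos by simp_all
  hence prodpos: "x * theta3 x ^ 2 > 0" "y * theta3 y ^ 2 > 0"
    using assms y by simp_all
  have scale: "x * (y * theta3 y ^ 2) = theta3 y ^ 2"
    using assms by (simp add: y_def)
  have "theta3 y ^ 2 = x * theta3 x ^ 2"
  proof (cases "k \<le> l'")
    case True
    hence "l \<le> k'" using dual by blast
    have "theta3 y ^ 2 \<le> x * theta3 x ^ 2"
      by (rule inv[OF agm_limit_mono[OF agm(1,4) True] sqpos(2) prodpos(1)])
    moreover have "theta3 x ^ 2 \<le> y * theta3 y ^ 2"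
      by (rule inv[OF agm_limit_mono[OF agm(3,2) \<open>l \<le> k'\<close>] sqpos(1) prodpos(2)])
    hence "x * theta3 x ^ 2 \<le> x * (y * theta3 y ^ 2)"
      using assms by (intro mult_left_mono) auto
    ultimately show ?thesis
      unfolding scale by (rule antisym)
  next
    case False
    hence "l' \<le> k" "k' \<le> l" using dual by linarith+
    have "x * theta3 x ^ 2 \<le> theta3 y ^ 2"
      by (rule inv[OF agm_limit_mono[OF agm(4,1) \<open>l' \<le> k\<close>] prodpos(1) sqpos(2)])
    moreover have "y * theta3 y ^ 2 \<le> theta3 x ^ 2"
      by (rule inv[OF agm_limit_mono[OF agm(2,3) \<open>k' \<le> l\<close>] prodpos(2) sqpos(1)])
    hence "x * (y * theta3 y ^ 2) \<le> x * theta3 x ^ 2"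
      using assms by (intro mult_left_mono) auto
    ultimately show ?thesis
      unfolding scale by (rule antisym[rotated])
  qed
  hence "theta3 y ^ 2 = (sqrt x * theta3 x) ^ 2"
    using assms by (simp add: power_mult_distrib)
  moreover have "sqrt x * theta3 x \<ge> 0"
    using pos assms by simp
  ultimately show ?thesis
    unfolding y_def [symmetric] using pos by (metis less_imp_le power2_eq_imp_eq)
qed

text \<open>Both sides are combinations of \<open>theta3\<close> at two arguments with ratio 4, so
  the inversion of \<open>theta3\<close> applies term by term.\<close>

lemma theta2_inversion:
  assumes "x > 0"
  shows "theta2 (1 / x) = sqrt x * theta4 x"
proof -
  have "theta2 (1 / x) = theta3 (1 / (4 * x)) - theta3 (1 / x)"
    using theta_even_odd(1)[of "1 / (4 * x)"] assms by simp
  also have "\<dots> = sqrt x * (2 * theta3 (4 * x) - theta3 x)"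
    using theta3_inversion[of "4 * x"] theta3_inversion[of x] assms
    by (simp add: real_sqrt_mult algebra_simps)
  also have "2 * theta3 (4 * x) - theta3 x = theta4 x"
    using theta_even_odd[OF assms] by simp
  finally show ?thesis .
qed

text \<open>Positivity is hidden by the alternating signs; inversion moves it to
  \<open>theta2\<close>, all of whose terms are positive.\<close>

lemma theta4_pos:
  assumes "x > 0"
  shows "theta4 x > 0"
  using theta2_inversion[OF assms] theta2_pos[of "1 / x"] assms
  by (simp add: zero_less_mult_iff)

section \<open>From the character sum back to the series \<open>psi\<close>, and the inversion of
  \<open>psiF\<close>\<close>

lemma chi8_uminus: "odd n \<Longrightarrow> chi8 (- n) = chi8 n"
  using odd_mod_8[of n] by (auto simp: chi8_def zmod_zminus1_eq_if)

lemma chi8_odd: "chi8 (2 * int k + 1) = (-1) ^ (k * (k + 1) div 2)"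
proof -
  \<comment> \<open>Both sides have period 4 in \<open>k\<close>, which leaves four cases.\<close>
  obtain j r where k: "k = 4 * j + r" and "r < 4"
    by (metis mod_less_divisor mult_div_mod_eq zero_less_numeral)
  have "r = 0 \<or> r = 1 \<or> r = 2 \<or> r = 3"
    using \<open>r < 4\<close> by linarith
  moreover have T: "k * (k + 1) = 2 * (8 * j * j + 4 * j * r + 2 * j) + r * (r + 1)"
    unfolding k by (simp add: algebra_simps)
  have "k * (k + 1) div 2 = (8 * j * j + 4 * j * r + 2 * j) + r * (r + 1) div 2"
    unfolding T by simp
  hence "(-1 :: real) ^ (k * (k + 1) div 2) = (-1) ^ (r * (r + 1) div 2)"
    by (simp add: power_add power_mult)
  moreover have "(2 * int k + 1) mod 8 = (2 * int r + 1) mod 8"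
  proof -
    have "2 * int k + 1 = (2 * int r + 1) + 8 * int j"
      by (simp add: k)
    thus ?thesis
      by (metis mod_mult_self2)
  qed
  ultimately show ?thesis
    by (auto simp: chi8_def)
qed

lemma psiF_eq_psi:
  assumes "x > 0"
  shows "psiF x = exp (- (pi * x / 8)) * psi (- exp (- (pi * x)))"
proof -
  define y where "y = pi * x / 8"
  have y: "y > 0" using assms by (simp add: y_def)
  define g where "g = (\<lambda>n::int. chi8 n * exp (- (y * of_int n ^ 2)))"
  have summ: "g summable_on A" for A
    unfolding g_def by (rule theta_sum_summable[OF y]) simp
  have "2 * psiF x = infsum g {n. odd n}"
    by (simp add: psiF_def theta_sum_def g_def y_def)
  also have "{n::int. odd n} = {n. odd n \<and> n > 0} \<union> {n. odd n \<and> n < 0}"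
    by (auto simp: not_less intro: le_neq_trans)
  also have "infsum g \<dots> = infsum g {n. odd n \<and> n > 0} + infsum g {n. odd n \<and> n < 0}"
    by (rule infsum_Un_disjoint[OF summ summ]) auto
  also have "infsum g {n. odd n \<and> n < 0} = infsum g {n. odd n \<and> n > 0}"
    by (rule infsum_reindex_bij_witness[where i = uminus and j = uminus]) (auto simp: g_def chi8_uminus)
  finally have "infsum g {n. odd n \<and> n > 0} = psiF x" by simp
  hence "(g has_sum psiF x) {n. odd n \<and> n > 0}"
    using has_sum_infsum[OF summ] by metis
  hence "((\<lambda>k. g (2 * int k + 1)) has_sum psiF x) UNIV"
    by (subst has_sum_reindex_bij_witness[where i = "\<lambda>n. nat (n div 2)" and j = "\<lambda>k. 2 * int k + 1"
          and T = "{n. odd n \<and> n > 0}" and h = g]) auto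
  hence sums: "(\<lambda>k. g (2 * int k + 1)) sums psiF x"
    by (rule has_sum_imp_sums)
  have "g (2 * int k + 1) = exp (- y) * (- exp (- (pi * x))) ^ (k * (k + 1) div 2)" for k
  proof -
    define T where "T = k * (k + 1) div 2"
    have T: "k * (k + 1) = 2 * T" by (simp add: T_def)
    have "chi8 (2 * int k + 1) = (-1) ^ T"
      unfolding T_def by (rule chi8_odd)
    moreover have "real_of_int (2 * int k + 1) ^ 2 = 1 + 8 * real T"
    proof -
      have "real (k * (k + 1)) = 2 * real T" unfolding T by simp
      thus ?thesis by (simp add: power2_eq_square algebra_simps)
    qed
    hence "exp (- (y * real_of_int (2 * int k + 1) ^ 2)) = exp (- y) * exp (- (pi * x)) ^ T"
      by (simp add: y_def exp_of_nat_mult [symmetric] exp_add [symmetric] algebra_simps)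
    ultimately show ?thesis
      unfolding g_def T_def [symmetric] by (simp add: power_minus[of "exp _"])
  qed
  with sums have "(\<lambda>k. exp (- y) * (- exp (- (pi * x))) ^ (k * (k + 1) div 2)) sums psiF x"
    by simp
  hence "(\<lambda>k. exp y * (exp (- y) * (- exp (- (pi * x))) ^ (k * (k + 1) div 2))) sums (exp y * psiF x)"
    by (rule sums_mult)
  hence "(\<lambda>k. (- exp (- (pi * x))) ^ (k * (k + 1) div 2)) sums (exp y * psiF x)"
    by (simp add: mult.assoc [symmetric] exp_add [symmetric])
  hence "psi (- exp (- (pi * x))) = exp y * psiF x"
    unfolding psi_def by (rule sums_unique [symmetric])
  thus ?thesis
    unfolding y_def by (simp add: mult.assoc [symmetric] exp_add [symmetric])
qed

lemma le_triangular: "i \<le> i * (i + 1) div 2" for i :: nat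
proof -
  have "2 * i \<le> i * (i + 1)" by (cases i) auto
  thus ?thesis by linarith
qed

lemma continuous_on_psi:
  assumes "r < 1"
  shows "continuous_on {- r..r} psi"
proof (cases "r \<ge> 0")
  case True
  have "uniform_limit {- r..r} (\<lambda>n q. \<Sum>i<n. q ^ (i * (i + 1) div 2)) psi sequentially"
    unfolding psi_def
  proof (rule Weierstrass_m_test)
    show "summable (\<lambda>i. r ^ i)" using True assms by simp
    fix i q assume q: "q \<in> {- r..r}"
    have "\<bar>q\<bar> \<le> r" using q by auto
    hence "norm (q ^ (i * (i + 1) div 2)) \<le> r ^ (i * (i + 1) div 2)"
      by (simp add: power_abs power_mono)
    also have "\<dots> \<le> r ^ i"
      using True assms by (intro power_decreasing le_triangular) auto
    finally show "norm (q ^ (i * (i + 1) div 2)) \<le> r ^ i" .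
  qed
  thus ?thesis
    by (rule uniform_limit_theorem[rotated]) (auto intro!: always_eventually continuous_intros)
qed simp

text \<open>\<open>psiF_square\<close> only shows that \<open>psiF\<close> does not vanish, hence
  that \<open>psi\<close> has no zero between -1 and 0. Since \<open>psi 0 = 1\<close>, the
  intermediate value theorem then fixes the sign.\<close>

lemma psiF_pos:
  assumes "x > 0"
  shows "psiF x > 0"
proof -
  have nz: "psi (- q) \<noteq> 0" if "0 < q" "q < 1" for q
  proof -
    define t where "t = - ln q / pi"
    have t: "t > 0" "exp (- (pi * t)) = q" using that by (auto simp: t_def divide_neg_pos)
    have "psiF t \<noteq> 0"
      using psiF_square[OF t(1)] theta2_pos[OF t(1)] theta4_pos[OF t(1)] by auto
    thus ?thesis
      using psiF_eq_psi[OF t(1)] t(2) by auto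
  qed
  \<comment> \<open>The constant term is \<open>0 ^ 0 = 1\<close>; every other exponent is
    positive.\<close>
  have psi0: "psi 0 = 1"
  proof -
    have "(\<lambda>n. (0::real) ^ (n * (n + 1) div 2)) = (\<lambda>n. if n = 0 then 1 else 0)"
    proof
      fix n :: nat
      have "n \<noteq> 0 \<Longrightarrow> n * (n + 1) div 2 \<noteq> 0"
        using le_triangular[of n] by linarith
      thus "(0::real) ^ (n * (n + 1) div 2) = (if n = 0 then 1 else 0)"
        by simp
    qed
    thus ?thesis
      unfolding psi_def using suminf_finite[of "{0::nat}" "\<lambda>n. if n = 0 then 1 else (0::real)"] by simp
  qed
  define q where "q = exp (- (pi * x))"
  have q: "0 < q" "q < 1" using assms by (auto simp: q_def)
  have "psi (- q) > 0"
  proof (rule ccontr)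
    assume "\<not> psi (- q) > 0"
    moreover have "continuous_on {- q..0} psi"
      using continuous_on_psi[OF q(2)] by (rule continuous_on_subset) (use q in auto)
    ultimately obtain s where "- q \<le> s" "s \<le> 0" "psi s = 0"
      using IVT'[of psi "- q" 0 0] q psi0 by auto
    thus False
      using nz[of "- s"] q psi0 by (cases "s = 0") auto
  qed
  thus ?thesis
    using psiF_eq_psi[OF assms] by (simp add: q_def)
qed

text \<open>Inversion exchanges \<open>theta2\<close> and \<open>theta4\<close>, so their product,
  twice the square of \<open>psiF\<close>, only acquires the factor \<open>x\<close>. Positivity
  selects the root.\<close>

lemma psiF_inversion:
  assumes "x > 0"
  shows "psiF (1 / x) = sqrt x * psiF x"
proof -
  have "theta4 (1 / x) = sqrt x * theta2 x"
    using theta2_inversion[of "1 / x"] assms by (simp add: real_sqrt_divide field_simps)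
  hence "2 * psiF (1 / x) ^ 2 = (sqrt x * sqrt x) * (2 * psiF x ^ 2)"
    unfolding psiF_square[OF assms] using psiF_square[of "1 / x"] theta2_inversion[OF assms] assms
    by simp
  also have "sqrt x * sqrt x = x"
    using assms by simp
  finally have "psiF (1 / x) ^ 2 = (sqrt x * psiF x) ^ 2"
    using assms by (simp add: power_mult_distrib)
  moreover have "psiF (1 / x) \<ge> 0" "sqrt x * psiF x \<ge> 0"
    using psiF_pos[OF assms] psiF_pos[of "1 / x"] assms by auto
  ultimately show ?thesis
    by (metis power2_eq_imp_eq)
qed

section \<open>Identities of degree 15\<close>

lemma lat_union:
  assumes "y > 0" "z > 0" "S \<inter> T = {}"
  shows "lat (S \<union> T) y z = lat S y z + lat T y z"
  using assms by (intro infsum_Un_disjoint gauss2_summable)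

text \<open>
  The bijections of the next lemmas multiply elements of ideals of the ring of integers of
  \<open>\<rat>(sqrt (-15))\<close> by fixed elements, which scales the norm form.
\<close>

lemma psiF_degree_15_difference:
  assumes "x > 0"
  shows "theta2 (3 * x / 2) * theta2 (5 * x / 2) / 2 - 2 * psiF (3 * x) * psiF (5 * x) = theta2 x * theta2 (15 * x)"
proof -
  have pos: "pi * (3 * x / 2) / 4 > 0" "pi * (5 * x / 2) / 4 > 0" "pi * x / 4 > 0" "pi * (15 * x) / 4 > 0"
    using assms by auto
  have arg: "pi * (3 * x) / 8 = pi * (3 * x / 2) / 4" "pi * (5 * x) / 8 = pi * (5 * x / 2) / 4" by simp_all
  have "lat (odd_lat 1 4) (pi * x / 4) (pi * (15 * x) / 4) = lat (odd_lat 5 8) (pi * (3 * x / 2) / 4) (pi * (5 * x / 2) / 4)"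
  proof (rule lat_bij_form[where i = "\<lambda>(s, t). ((s + 5 * t) div 2, (s - 3 * t) div 2)"
      and j = "\<lambda>(m, n). ((3 * m + 5 * n) div 4, (m - n) div 4)"
      and A = 2 and B = 30 and A' = 3 and B' = 5 and r = "pi * x / 8"])
    fix s t assume "(s, t) \<in> odd_lat 1 4"
    then obtain k where st: "s = t + 4 * k" "odd t"
      unfolding odd_lat_def by (auto simp: mod_0_imp_dvd dvd_def algebra_simps)
    \<comment> \<open>The image (m, n) satisfies m - 5n = 8(t - k); this is how the modulus 4
      becomes 8.\<close>
    have div: "(s + 5 * t) div 2 = 3 * t + 2 * k" "(s - 3 * t) div 2 = - t + 2 * k"
      unfolding st by presburger+
    show "2 * s ^ 2 + 30 * t ^ 2 =
      3 * fst ((\<lambda>(s, t). ((s + 5 * t) div 2, (s - 3 * t) div 2)) (s, t)) ^ 2 +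
      5 * snd ((\<lambda>(s, t). ((s + 5 * t) div 2, (s - 3 * t) div 2)) (s, t)) ^ 2"
      unfolding prod.case div unfolding st(1) by (simp add: power2_eq_square algebra_simps)
    show "(\<lambda>(s, t). ((s + 5 * t) div 2, (s - 3 * t) div 2)) (s, t) \<in> odd_lat 5 8"
      unfolding prod.case div odd_lat_def using st(2) by simp
    show "(\<lambda>(m, n). ((3 * m + 5 * n) div 4, (m - n) div 4)) ((\<lambda>(s, t). ((s + 5 * t) div 2, (s - 3 * t) div 2)) (s, t)) = (s, t)"
      unfolding prod.case div unfolding st(1) by simp
  next
    fix m n assume "(m, n) \<in> odd_lat 5 8"
    then obtain l where mn: "m = 5 * n + 8 * l" "odd n"
      unfolding odd_lat_def by (auto simp: mod_0_imp_dvd dvd_def algebra_simps)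
    have div: "(3 * m + 5 * n) div 4 = 5 * n + 6 * l" "(m - n) div 4 = n + 2 * l"
      unfolding mn by presburger+
    show "(\<lambda>(m, n). ((3 * m + 5 * n) div 4, (m - n) div 4)) (m, n) \<in> odd_lat 1 4"
      unfolding prod.case div odd_lat_def using mn(2) by simp
    show "(\<lambda>(s, t). ((s + 5 * t) div 2, (s - 3 * t) div 2)) ((\<lambda>(m, n). ((3 * m + 5 * n) div 4, (m - n) div 4)) (m, n)) = (m, n)"
      unfolding prod.case div unfolding mn(1) by simp
  qed simp_all
  \<comment> \<open>The difference on the left is twice the sum over the class 5 modulo 8, and the
    right side is twice the sum over the class 1 modulo 4.\<close>
  thus ?thesis
    using odd_products[OF pos(1,2)] odd_products[OF pos(3,4)]
    unfolding theta2_def psiF_def arg by (simp add: field_simps)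
qed

text \<open>The companion with the two forms exchanged: the left side is twice the sum over the
  class 1 modulo 8. The substitution produces the class -1, which a reflection identifies with
  it.\<close>

lemma psiF_degree_15_sum:
  assumes "x > 0"
  shows "theta2 (x / 2) * theta2 (15 * x / 2) / 2 + 2 * psiF x * psiF (15 * x) = theta2 (3 * x) * theta2 (5 * x)"
proof -
  have pos: "pi * (x / 2) / 4 > 0" "pi * (15 * x / 2) / 4 > 0" "pi * (3 * x) / 4 > 0" "pi * (5 * x) / 4 > 0"
    using assms by auto
  have arg: "pi * x / 8 = pi * (x / 2) / 4" "pi * (15 * x) / 8 = pi * (15 * x / 2) / 4" by simp_all
  have "lat (odd_lat 1 4) (pi * (3 * x) / 4) (pi * (5 * x) / 4) = lat (odd_lat (-1) 8) (pi * (x / 2) / 4) (pi * (15 * x / 2) / 4)"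
  proof (rule lat_bij_form[where i = "\<lambda>(s, t). ((3 * s - 5 * t) div 2, (s + t) div 2)"
      and j = "\<lambda>(m, n). ((m + 5 * n) div 4, (3 * n - m) div 4)"
      and A = 6 and B = 10 and A' = 1 and B' = 15 and r = "pi * x / 8"])
    fix s t assume "(s, t) \<in> odd_lat 1 4"
    then obtain k where st: "s = t + 4 * k" "odd t"
      unfolding odd_lat_def by (auto simp: mod_0_imp_dvd dvd_def algebra_simps)
    have div: "(3 * s - 5 * t) div 2 = - t + 6 * k" "(s + t) div 2 = t + 2 * k"
      unfolding st by presburger+
    show "6 * s ^ 2 + 10 * t ^ 2 =
      1 * fst ((\<lambda>(s, t). ((3 * s - 5 * t) div 2, (s + t) div 2)) (s, t)) ^ 2 +
      15 * snd ((\<lambda>(s, t). ((3 * s - 5 * t) div 2, (s + t) div 2)) (s, t)) ^ 2"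
      unfolding prod.case div unfolding st(1) by (simp add: power2_eq_square algebra_simps)
    show "(\<lambda>(s, t). ((3 * s - 5 * t) div 2, (s + t) div 2)) (s, t) \<in> odd_lat (-1) 8"
      unfolding prod.case div odd_lat_def using st(2) by simp
    show "(\<lambda>(m, n). ((m + 5 * n) div 4, (3 * n - m) div 4)) ((\<lambda>(s, t). ((3 * s - 5 * t) div 2, (s + t) div 2)) (s, t)) = (s, t)"
      unfolding prod.case div unfolding st(1) by simp
  next
    fix m n assume "(m, n) \<in> odd_lat (-1) 8"
    then obtain l where mn: "m = - n + 8 * l" "odd n"
      unfolding odd_lat_def by (auto simp: mod_0_imp_dvd dvd_def algebra_simps)
    have div: "(m + 5 * n) div 4 = n + 2 * l" "(3 * n - m) div 4 = n - 2 * l"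
      unfolding mn by presburger+
    show "(\<lambda>(m, n). ((m + 5 * n) div 4, (3 * n - m) div 4)) (m, n) \<in> odd_lat 1 4"
      unfolding prod.case div odd_lat_def using mn(2) by simp
    show "(\<lambda>(s, t). ((3 * s - 5 * t) div 2, (s + t) div 2)) ((\<lambda>(m, n). ((m + 5 * n) div 4, (3 * n - m) div 4)) (m, n)) = (m, n)"
      unfolding prod.case div unfolding mn(1) by simp
  qed simp_all
  thus ?thesis
    using odd_products[OF pos(1,2)] odd_products[OF pos(3,4)]
      odd_lat_flip[where k = 1 and N = 8 and y = "pi * (x / 2) / 4" and z = "pi * (15 * x / 2) / 4"]
    unfolding theta2_def psiF_def arg by (simp add: field_simps)
qed

text \<open>Pairs with odd coordinate sum on the left correspond to the class 1 modulo 8 on the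
  right, since (a + 5b) - (a - 3b) = 8b.\<close>

lemma theta4_degree_15_difference:
  assumes "x > 0"
  shows "theta3 x * theta3 (15 * x) - theta4 x * theta4 (15 * x) =
    theta2 (3 * x / 2) * theta2 (5 * x / 2) / 2 + 2 * psiF (3 * x) * psiF (5 * x)"
proof -
  have pos: "pi * (3 * x / 2) / 4 > 0" "pi * (5 * x / 2) / 4 > 0" "pi * x > 0" "pi * (15 * x) > 0"
    using assms by auto
  have arg: "pi * (3 * x) / 8 = pi * (3 * x / 2) / 4" "pi * (5 * x) / 8 = pi * (5 * x / 2) / 4" by simp_all
  have "lat {p. odd (fst p + snd p)} (pi * x) (pi * (15 * x)) = lat (odd_lat 1 8) (pi * (3 * x / 2) / 4) (pi * (5 * x / 2) / 4)"
  proof (rule lat_bij_form[where i = "\<lambda>(a, b). (a + 5 * b, a - 3 * b)"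
        and j = "\<lambda>(m, n). ((3 * m + 5 * n) div 8, (m - n) div 8)"
        and A = 8 and B = 120 and A' = 3 and B' = 5 and r = "pi * x / 8"])
    fix m n assume "(m, n) \<in> odd_lat 1 8"
    then obtain l where mn: "m = n + 8 * l" "odd n"
      unfolding odd_lat_def by (auto simp: mod_0_imp_dvd dvd_def algebra_simps)
    have div: "(3 * m + 5 * n) div 8 = n + 3 * l" "(m - n) div 8 = l"
      unfolding mn by presburger+
    show "(\<lambda>(m, n). ((3 * m + 5 * n) div 8, (m - n) div 8)) (m, n) \<in> {p. odd (fst p + snd p)}"
      unfolding prod.case div using mn(2) by simp
    show "(\<lambda>(a, b). (a + 5 * b, a - 3 * b)) ((\<lambda>(m, n). ((3 * m + 5 * n) div 8, (m - n) div 8)) (m, n)) = (m, n)"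
      unfolding prod.case div unfolding mn(1) by simp
  qed (simp_all add: odd_lat_def power2_eq_square algebra_simps)
  thus ?thesis
    using odd_products[OF pos(1,2)] full_products[OF pos(3,4)]
    unfolding theta2_def theta3_def theta4_def psiF_def arg by (simp add: field_simps)
qed


section \<open>Pairs of equal parity sorted by their difference modulo 4, for the fourth
  identity\<close>

definition even_lat :: "int \<Rightarrow> (int \<times> int) set" where
  "even_lat k = {p. even (fst p) \<and> even (snd p) \<and> (fst p - snd p) mod 4 = k}"

text \<open>For odd m and n, the difference is 2 modulo 4 exactly when m = -n modulo 4. The odd
  parts of the two sets are therefore mirror images.\<close>

lemma cong_4_split:
  "{p :: int \<times> int. (fst p - snd p) mod 4 = 0} = even_lat 0 \<union> odd_lat 1 4"
  "{p :: int \<times> int. (fst p - snd p) mod 4 = 2} = even_lat 2 \<union> odd_lat (-1) 4"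
proof -
  have *: "(m - n) mod 4 = 0 \<longleftrightarrow> even m \<and> even n \<and> (m - n) mod 4 = 0 \<or> odd m \<and> odd n \<and> (m - 1 * n) mod 4 = 0"
    "(m - n) mod 4 = 2 \<longleftrightarrow> even m \<and> even n \<and> (m - n) mod 4 = 2 \<or> odd m \<and> odd n \<and> (m - (-1) * n) mod 4 = 0"
    for m n :: int
    by presburger+
  show "{p :: int \<times> int. (fst p - snd p) mod 4 = 0} = even_lat 0 \<union> odd_lat 1 4"
    "{p :: int \<times> int. (fst p - snd p) mod 4 = 2} = even_lat 2 \<union> odd_lat (-1) 4"
    unfolding even_lat_def odd_lat_def Collect_disj_eq [symmetric] by (rule Collect_cong, rule *)+
qed

lemma even_sum_lat_degree_15:
  "lat {p. even (fst p + snd p)} (pi * x) (pi * (15 * x)) =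
   lat {p. (fst p - snd p) mod 4 = 0} (3 * pi * x / 2) (5 * pi * x / 2)"
proof (rule lat_bij_form[where i = "\<lambda>(s, t). ((s + 5 * t) div 2, (s - 3 * t) div 2)"
      and j = "\<lambda>(m, n). ((3 * m + 5 * n) div 4, (m - n) div 4)"
      and A = 2 and B = 30 and A' = 3 and B' = 5 and r = "pi * x / 2"])
  fix s t :: int assume "(s, t) \<in> {p. even (fst p + snd p)}"
  hence "even (s - t)" by simp
  then obtain k where "s - t = 2 * k" by (rule evenE)
  hence st: "s = t + 2 * k" by simp
  have div: "(s + 5 * t) div 2 = 3 * t + k" "(s - 3 * t) div 2 = - t + k"
    unfolding st by presburger+
  show "2 * s ^ 2 + 30 * t ^ 2 =
    3 * fst ((\<lambda>(s, t). ((s + 5 * t) div 2, (s - 3 * t) div 2)) (s, t)) ^ 2 +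
    5 * snd ((\<lambda>(s, t). ((s + 5 * t) div 2, (s - 3 * t) div 2)) (s, t)) ^ 2"
    unfolding prod.case div unfolding st by (simp add: power2_eq_square algebra_simps)
  show "(\<lambda>(s, t). ((s + 5 * t) div 2, (s - 3 * t) div 2)) (s, t) \<in> {p. (fst p - snd p) mod 4 = 0}"
    unfolding prod.case div by simp
  show "(\<lambda>(m, n). ((3 * m + 5 * n) div 4, (m - n) div 4)) ((\<lambda>(s, t). ((s + 5 * t) div 2, (s - 3 * t) div 2)) (s, t)) = (s, t)"
    unfolding prod.case div unfolding st by simp
next
  fix m n :: int assume "(m, n) \<in> {p. (fst p - snd p) mod 4 = 0}"
  hence "4 dvd m - n" by (simp add: mod_eq_0_iff_dvd)
  then obtain k where "m - n = 4 * k" by (rule dvdE)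
  hence m: "m = n + 4 * k" by simp
  have div: "(3 * m + 5 * n) div 4 = 2 * n + 3 * k" "(m - n) div 4 = k"
    unfolding m by presburger+
  show "(\<lambda>(m, n). ((3 * m + 5 * n) div 4, (m - n) div 4)) (m, n) \<in> {p. even (fst p + snd p)}"
    unfolding prod.case div by simp
  show "(\<lambda>(s, t). ((s + 5 * t) div 2, (s - 3 * t) div 2)) ((\<lambda>(m, n). ((3 * m + 5 * n) div 4, (m - n) div 4)) (m, n)) = (m, n)"
    unfolding prod.case div unfolding m by simp
qed auto

lemma odd_lat_degree_15:
  "lat (odd_lat 1 4) (pi * x / 4) (pi * (15 * x) / 4) =
   lat {p. (fst p - snd p) mod 4 = 2} (3 * pi * x / 2) (5 * pi * x / 2)"
proof (rule lat_bij_form[where i = "\<lambda>(s, t). ((s - 5 * t) div 4, (s + 3 * t) div 4)"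
      and j = "\<lambda>(m, n). ((3 * m + 5 * n) div 2, (n - m) div 2)"
      and A = 1 and B = 15 and A' = 6 and B' = 10 and r = "pi * x / 4"])
  fix s t assume "(s, t) \<in> odd_lat 1 4"
  then obtain k where st: "s = t + 4 * k" "odd t"
    unfolding odd_lat_def by (auto simp: mod_0_imp_dvd dvd_def algebra_simps)
  have div: "(s - 5 * t) div 4 = k - t" "(s + 3 * t) div 4 = t + k"
    unfolding st by presburger+
  thus "1 * s ^ 2 + 15 * t ^ 2 =
    6 * fst ((\<lambda>(s, t). ((s - 5 * t) div 4, (s + 3 * t) div 4)) (s, t)) ^ 2 +
    10 * snd ((\<lambda>(s, t). ((s - 5 * t) div 4, (s + 3 * t) div 4)) (s, t)) ^ 2"
    unfolding st(1) by (simp add: power2_eq_square algebra_simps)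
  have "((k - t) - (t + k)) mod 4 = 2"
    using st(2) by presburger
  thus "(\<lambda>(s, t). ((s - 5 * t) div 4, (s + 3 * t) div 4)) (s, t) \<in> {p. (fst p - snd p) mod 4 = 2}"
    unfolding prod.case mem_Collect_eq fst_conv snd_conv div .
  show "(\<lambda>(m, n). ((3 * m + 5 * n) div 2, (n - m) div 2)) ((\<lambda>(s, t). ((s - 5 * t) div 4, (s + 3 * t) div 4)) (s, t)) = (s, t)"
    unfolding prod.case div unfolding st(1) by simp
next
  fix m n :: int assume "(m, n) \<in> {p. (fst p - snd p) mod 4 = 2}"
  hence "(m - n) mod 4 = 2" by simp
  moreover define k where "k = (m - n) div 4"
  ultimately have m: "m = n + 4 * k + 2"
    by presburger
  have div: "(3 * m + 5 * n) div 2 = 4 * n + 6 * k + 3" "(n - m) div 2 = - 2 * k - 1"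
    unfolding m by presburger+
  have "((4 * n + 6 * k + 3) - 1 * (- 2 * k - 1)) mod 4 = 0"
    by presburger
  thus "(\<lambda>(m, n). ((3 * m + 5 * n) div 2, (n - m) div 2)) (m, n) \<in> odd_lat 1 4"
    unfolding odd_lat_def prod.case mem_Collect_eq fst_conv snd_conv div by simp
  show "(\<lambda>(s, t). ((s - 5 * t) div 4, (s + 3 * t) div 4)) ((\<lambda>(m, n). ((3 * m + 5 * n) div 2, (n - m) div 2)) (m, n)) = (m, n)"
    unfolding prod.case div prod.inject unfolding m by presburger
qed auto

lemma even_lat_scale:
  "lat {p. even (fst p + snd p)} (4 * y) (4 * z) = lat (even_lat 0) y z"
  "lat {p. odd (fst p + snd p)} (4 * y) (4 * z) = lat (even_lat 2) y z"
proof -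
  have *: "even (c + d) \<longleftrightarrow> even (2 * c) \<and> even (2 * d) \<and> (2 * c - 2 * d) mod 4 = 0"
    "odd (c + d) \<longleftrightarrow> even (2 * c) \<and> even (2 * d) \<and> (2 * c - 2 * d) mod 4 = 2" for c d :: int
    by presburger+
  have "lat {p. (2 * fst p, 2 * snd p) \<in> S} (4 * y) (4 * z) = lat S y z"
    if "\<And>p. p \<in> S \<Longrightarrow> even (fst p) \<and> even (snd p)" for S
    by (rule lat_bij[where i = "\<lambda>p. (2 * fst p, 2 * snd p)" and j = "\<lambda>p. (fst p div 2, snd p div 2)"])
       (use that in auto)
  note scale = this
  have sets: "{p. even (fst p + snd p)} = {p. (2 * fst p, 2 * snd p) \<in> even_lat 0}"
    "{p. odd (fst p + snd p)} = {p. (2 * fst p, 2 * snd p) \<in> even_lat 2}"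
    unfolding even_lat_def mem_Collect_eq fst_conv snd_conv by (rule Collect_cong, rule *)+
  show "lat {p. even (fst p + snd p)} (4 * y) (4 * z) = lat (even_lat 0) y z"
    "lat {p. odd (fst p + snd p)} (4 * y) (4 * z) = lat (even_lat 2) y z"
    unfolding sets by (rule scale, simp add: even_lat_def)+
qed

text \<open>Let E0, E2 be the sums over even pairs with difference 0 or 2 modulo 4, and O the sum
  over odd pairs of the class 1 modulo 4. The left side is 2(E0 + O) - 2(E2 + O), so the odd parts
  cancel, and E0 - E2 is a product of two \<open>theta4\<close>.\<close>

lemma theta4_degree_15_sum:
  assumes "x > 0"
  shows "theta3 x * theta3 (15 * x) + theta4 x * theta4 (15 * x) - theta2 x * theta2 (15 * x) =
    2 * theta4 (6 * x) * theta4 (10 * x)"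
proof -
  define y z where "y = 3 * pi * x / 2" and "z = 5 * pi * x / 2"
  have pos: "y > 0" "z > 0" "pi * x > 0" "pi * (15 * x) > 0" "pi * x / 4 > 0" "pi * (15 * x) / 4 > 0"
    using assms by (auto simp: y_def z_def)
  have arg: "pi * (6 * x) = 4 * y" "pi * (10 * x) = 4 * z" and pos': "4 * y > 0" "4 * z > 0"
    using pos by (simp_all add: y_def z_def)
  have disj: "even_lat k \<inter> odd_lat l 4 = {}" for k l
    by (auto simp: even_lat_def odd_lat_def)
  have 1: "lat {p. even (fst p + snd p)} (pi * x) (pi * (15 * x)) = lat (even_lat 0) y z + lat (odd_lat 1 4) y z"
    unfolding even_sum_lat_degree_15 cong_4_split y_def [symmetric] z_def [symmetric] by (rule lat_union[OF pos(1,2) disj])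
  have "lat (odd_lat 1 4) (pi * x / 4) (pi * (15 * x) / 4) = lat (even_lat 2) y z + lat (odd_lat (-1) 4) y z"
    unfolding odd_lat_degree_15 cong_4_split y_def [symmetric] z_def [symmetric] by (rule lat_union[OF pos(1,2) disj])
  hence 2: "lat (odd_lat 1 4) (pi * x / 4) (pi * (15 * x) / 4) = lat (even_lat 2) y z + lat (odd_lat 1 4) y z"
    using odd_lat_flip[where k = 1 and N = 4 and y = y and z = z] by simp
  note full = full_products[OF pos(3,4)] full_products[OF pos', unfolded even_lat_scale]
  have "theta2 x * theta2 (15 * x) = 2 * (lat (even_lat 2) y z + lat (odd_lat 1 4) y z)"
    unfolding theta2_def odd_products(1)[OF pos(5,6)] 2 [symmetric] odd_products(3)[OF pos(5,6)] by simp
  moreover have "2 * theta4 (6 * x) * theta4 (10 * x) = 2 * (lat (even_lat 0) y z - lat (even_lat 2) y z)"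
    unfolding theta4_def arg mult.assoc full by simp
  moreover have "theta3 x * theta3 (15 * x) + theta4 x * theta4 (15 * x) = 2 * (lat (even_lat 0) y z + lat (odd_lat 1 4) y z)"
    unfolding theta3_def theta4_def full 1 by simp
  ultimately show ?thesis
    by simp
qed

text \<open>
  With moduli \<open>\<alpha>, \<beta>, \<gamma>, \<delta>\<close> at \<open>x, 3 * x, 5 * x, 15 * x\<close>, this is applied to the eighth roots
  \<open>a, a', b, b'\<close> of \<open>\<alpha> * \<delta>\<close>, \<open>(1 - \<alpha>) * (1 - \<delta>)\<close>, \<open>\<beta> * \<gamma>\<close> and \<open>(1 - \<beta>) * (1 - \<gamma>)\<close>.
\<close>

lemma mixed_modular_algebra:
  fixes a a' b b' k :: real
  assumes eqs: "a ^ 2 = k * b * (1 - b')" "a * (1 + a') = k * b ^ 2"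
    "1 - a' ^ 2 = k * b * (1 + b')" "1 + a' ^ 2 - a ^ 2 = 2 * k * b'"
    and pos: "a > 0" "a' > 0" "b > 0" "b' > 0" "k > 0"
  shows "k * b * b' * (1 - k) = a * a' * (1 + k)"
proof -
  define \<beta> where "\<beta> = k * b"
  have \<beta>: "\<beta> > 0" using pos by (simp add: \<beta>_def)
  have b: "b = \<beta> / k" using pos by (simp add: \<beta>_def)
  \<comment> \<open>The first and third equations rewrite the left side of the fourth as 2 - k b (1
    + b') - k b (1 - b') = 2 - 2 k b.\<close>
  have "k * b + k * b' = 1"
    using eqs(1,3,4) by (simp add: algebra_simps)
  hence b': "b' = (1 - \<beta>) / k"
    using pos by (simp add: \<beta>_def field_simps)
  have "(1 + a') ^ 2 * (k * b * (1 - b')) = (k * b ^ 2) ^ 2"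
    unfolding eqs(1,2) [symmetric] by (simp add: power_mult_distrib)
  hence "k * b * ((1 + a') ^ 2 * (1 - b')) = k * b * (k * b ^ 3)"
    by (simp add: power2_eq_square power3_eq_cube mult_ac)
  hence E1: "(1 + a') ^ 2 * (1 - b') = k * b ^ 3"
    using pos by simp
  have "(1 - a') * (1 + a') * ((1 + a') * (1 - b')) = (1 - a') * (k * b ^ 3)"
    unfolding E1 [symmetric] by (simp add: power2_eq_square)
  moreover have "(1 - a') * (1 + a') = k * b * (1 + b')"
    using eqs(3) by (simp add: power2_eq_square algebra_simps)
  ultimately have "(k * b * (1 + b')) * ((1 + a') * (1 - b')) = (1 - a') * (k * b ^ 3)"
    by (simp only:)
  hence "k * b * ((1 + b') * ((1 + a') * (1 - b'))) = k * b * ((1 - a') * b ^ 2)"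
    by (simp add: power2_eq_square power3_eq_cube mult_ac)
  hence E2: "(1 + b') * ((1 + a') * (1 - b')) = (1 - a') * b ^ 2"
    using pos by simp
  hence E2': "(1 + a') * (1 - b' ^ 2 + b ^ 2) = 2 * b ^ 2"
    by (simp add: power2_eq_square algebra_simps)
  have "(1 + a') * (k ^ 2 * (1 - b' ^ 2 + b ^ 2)) = k ^ 2 * ((1 + a') * (1 - b' ^ 2 + b ^ 2))"
    by (simp only: mult_ac)
  hence "(1 + a') * (k ^ 2 * (1 - b' ^ 2 + b ^ 2)) = 2 * (k ^ 2 * b ^ 2)"
    unfolding E2' by simp
  moreover have "k ^ 2 * b ^ 2 = \<beta> ^ 2"
    by (simp add: \<beta>_def power_mult_distrib)
  moreover have "k ^ 2 * (1 - b' ^ 2 + b ^ 2) = k ^ 2 - 1 + 2 * \<beta>"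
    unfolding b b' using pos by (simp add: field_simps power2_eq_square)
  \<comment> \<open>Now \<open>b\<close>, \<open>b'\<close> and \<open>a'\<close> are all rational
    in \<open>k\<close> and \<open>\<beta>\<close>; inserting them into \<open>E1\<close> leaves one
    equation between these two.\<close>
  ultimately have E3: "(1 + a') * (k ^ 2 - 1 + 2 * \<beta>) = 2 * \<beta> ^ 2"
    by simp
  define D where "D = k ^ 2 - 1 + 2 * \<beta>"
  have "(1 + a') * D > 0" using \<beta> by (simp add: E3[folded D_def])
  hence D: "D > 0" using pos by (simp add: zero_less_mult_iff)
  have a'1: "1 + a' = 2 * \<beta> ^ 2 / D"
    using E3 D by (simp add: D_def field_simps)
  have "k ^ 2 * ((1 + a') ^ 2 * (1 - b')) = k ^ 2 * (k * b ^ 3)"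
    unfolding E1 ..
  hence "k * (1 + a') ^ 2 * (k * (1 - b')) = \<beta> ^ 3"
    by (simp add: \<beta>_def power2_eq_square power3_eq_cube algebra_simps)
  moreover have "k * (1 - b') = k - 1 + \<beta>"
    unfolding b' using pos by (simp add: field_simps)
  ultimately have "k * (2 * \<beta> ^ 2 / D) ^ 2 * (k - 1 + \<beta>) = \<beta> ^ 3"
    unfolding a'1 by simp
  hence "4 * k * \<beta> ^ 4 * (k - 1 + \<beta>) = \<beta> ^ 3 * D ^ 2"
    using D by (simp add: field_simps power_divide power_mult_distrib)
  hence "\<beta> ^ 3 * (4 * k * \<beta> * (k - 1 + \<beta>)) = \<beta> ^ 3 * D ^ 2"
    by (simp add: power_numeral_reduce algebra_simps)
  hence "4 * k * \<beta> * (k - 1 + \<beta>) = D ^ 2"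
    using \<beta> by simp
  hence E4: "(k - 1) * (4 * \<beta> ^ 2 - 4 * \<beta>) = (k - 1) * ((k - 1) * (k + 1) ^ 2)"
    unfolding D_def by (simp add: power2_eq_square algebra_simps)
  \<comment> \<open>\<open>E4\<close> carries the spurious factor \<open>k - 1\<close>. At
    \<open>k = 1\<close> the relations would give a' = -b', against positivity.\<close>
  have "k \<noteq> 1"
  proof
    assume "k = 1"
    hence "(1 + a') * (2 * \<beta>) = 2 * \<beta> ^ 2" using E3 by simp
    hence "1 + a' = \<beta>" using \<beta> by (simp add: power2_eq_square)
    moreover have "b' = 1 - \<beta>" using b' \<open>k = 1\<close> by simp
    ultimately show False using pos by linarith
  qed
  hence E5: "4 * \<beta> ^ 2 - 4 * \<beta> = (k - 1) * (k + 1) ^ 2"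
    using E4 by simp
  have P: "4 * k * (k * b * b') = (1 - k) * (1 + k) ^ 2"
  proof -
    have "4 * k * (k * b * b') = 4 * \<beta> - 4 * \<beta> ^ 2"
      unfolding b b' using pos by (simp add: field_simps power2_eq_square)
    thus ?thesis using E5 by (simp add: algebra_simps)
  qed
  have Q: "4 * k * (a * a') = (k - 1) ^ 2 * (k + 1)"
  proof -
    have "k * (a * (1 + a')) = \<beta> ^ 2"
      unfolding eqs(2) by (simp add: \<beta>_def power2_eq_square)
    hence "2 * (k * a) * \<beta> ^ 2 = D * \<beta> ^ 2"
      unfolding a'1 using D by (simp add: field_simps)
    hence ka: "2 * (k * a) = D"
      using \<beta> by simp
    have "4 * k * (a * a') = 2 * (2 * (k * a)) * ((1 + a') - 1)"
      by (simp add: algebra_simps)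
    also have "\<dots> = 4 * \<beta> ^ 2 - 2 * D"
      unfolding ka using E3[folded D_def] by (simp add: algebra_simps)
    also have "\<dots> = (k - 1) ^ 2 * (k + 1)"
      using E5 unfolding D_def by (simp add: power2_eq_square algebra_simps)
    finally show ?thesis .
  qed
  have "4 * k * (k * b * b' * (1 - k)) = (4 * k * (k * b * b')) * (1 - k)"
    by simp
  also have "\<dots> = (4 * k * (a * a')) * (1 + k)"
    unfolding P Q by (simp add: algebra_simps power2_eq_square)
  finally have "4 * k * (k * b * b' * (1 - k)) = 4 * k * (a * a' * (1 + k))"
    by (simp only: mult_ac)
  thus ?thesis
    using pos by simp
qed

text \<open>The squares agree by the doubling relations. This expresses \<open>psiF\<close> through
  the quantities whose products are the eighth roots of the moduli.\<close>

lemma theta2_half_times_theta4: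
  assumes "x > 0"
  shows "theta2 (x / 2) * theta4 (2 * x) = 2 * psiF x * theta3 x"
proof (rule power2_eq_imp_eq)
  have "(theta2 (x / 2) * theta4 (2 * x)) ^ 2 = 2 * theta2 x * theta3 x * (theta3 x * theta4 x)"
    unfolding power_mult_distrib theta2_half_square[OF assms] theta3_times_theta4[OF assms, symmetric] ..
  also have "\<dots> = 2 * theta3 x ^ 2 * (2 * psiF x ^ 2)"
    unfolding psiF_square[OF assms] by (simp add: power2_eq_square)
  finally show "(theta2 (x / 2) * theta4 (2 * x)) ^ 2 = (2 * psiF x * theta3 x) ^ 2"
    by (simp add: power_mult_distrib)
qed (use assms theta2_pos[of "x / 2"] theta4_pos[of "2 * x"] psiF_pos[of x] theta3_pos[of x] in auto)

text \<open>The numbers \<open>A / X\<close>, \<open>A' / X\<close>, \<open>B / Y\<close>,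
  \<open>B' / Y\<close> are the eighth roots entering \<open>mixed_modular_algebra\<close>, with
  \<open>k = Y / X\<close>; its four hypotheses are the four lattice identities divided by
  \<open>X\<close>.\<close>

lemma psiF_degree_15:
  fixes x :: real
  assumes "x > 0"
  defines "X \<equiv> theta3 x * theta3 (15 * x)" and "Y \<equiv> theta3 (3 * x) * theta3 (5 * x)"
  shows "psiF (3 * x) * psiF (5 * x) * (X - Y) = psiF x * psiF (15 * x) * (X + Y)"
proof -
  have xs: "3 * x > 0" "5 * x > 0" "15 * x > 0" using assms by simp_all
  define A where "A = theta2 (x / 2) * theta2 (15 * x / 2) / 2"
  define B where "B = theta2 (3 * x / 2) * theta2 (5 * x / 2) / 2"
  define A' where "A' = theta4 (2 * x) * theta4 (30 * x)"
  define B' where "B' = theta4 (6 * x) * theta4 (10 * x)"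
  have pos: "X > 0" "Y > 0" "A > 0" "A' > 0" "B > 0" "B' > 0"
    using assms by (simp_all add: X_def Y_def A_def A'_def B_def B'_def theta2_pos theta3_pos theta4_pos)
  have AA': "2 * psiF x * psiF (15 * x) = A * A' / X"
  proof -
    have "A * A' = (theta2 (x / 2) * theta4 (2 * x)) * (theta2 (15 * x / 2) * theta4 (2 * (15 * x))) / 2"
      by (simp add: A_def A'_def)
    also have "\<dots> = 2 * psiF x * psiF (15 * x) * X"
      unfolding theta2_half_times_theta4[OF assms(1)] theta2_half_times_theta4[OF xs(3)]
      by (simp add: X_def)
    finally show ?thesis using pos(1) by simp
  qed
  have BB': "2 * psiF (3 * x) * psiF (5 * x) = B * B' / Y"
  proof -
    have "B * B' = (theta2 (3 * x / 2) * theta4 (2 * (3 * x))) * (theta2 (5 * x / 2) * theta4 (2 * (5 * x))) / 2"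
      by (simp add: B_def B'_def)
    also have "\<dots> = 2 * psiF (3 * x) * psiF (5 * x) * Y"
      unfolding theta2_half_times_theta4[OF xs(1)] theta2_half_times_theta4[OF xs(2)]
      by (simp add: Y_def)
    finally show ?thesis using pos(2) by simp
  qed
  have AA: "theta2 x * theta2 (15 * x) = A ^ 2 / X"
  proof -
    have "A ^ 2 = theta2 (x / 2) ^ 2 * theta2 (15 * x / 2) ^ 2 / 4"
      by (simp add: A_def power_mult_distrib power_divide)
    also have "\<dots> = X * (theta2 x * theta2 (15 * x))"
      unfolding theta2_half_square[OF assms(1)] theta2_half_square[OF xs(3)] by (simp add: X_def)
    finally show ?thesis using pos(1) by simp
  qed
  have BB: "theta2 (3 * x) * theta2 (5 * x) = B ^ 2 / Y"
  proof -
    have "B ^ 2 = theta2 (3 * x / 2) ^ 2 * theta2 (5 * x / 2) ^ 2 / 4"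
      by (simp add: B_def power_mult_distrib power_divide)
    also have "\<dots> = Y * (theta2 (3 * x) * theta2 (5 * x))"
      unfolding theta2_half_square[OF xs(1)] theta2_half_square[OF xs(2)] by (simp add: Y_def)
    finally show ?thesis using pos(2) by simp
  qed
  have CC: "theta4 x * theta4 (15 * x) = A' ^ 2 / X"
  proof -
    have "A' ^ 2 = theta4 (2 * x) ^ 2 * theta4 (2 * (15 * x)) ^ 2"
      by (simp add: A'_def power_mult_distrib)
    also have "\<dots> = X * (theta4 x * theta4 (15 * x))"
      unfolding theta3_times_theta4[OF assms(1), symmetric] theta3_times_theta4[OF xs(3), symmetric] by (simp add: X_def)
    finally show ?thesis using pos(1) by simp
  qed
  have eqs: "B - B * B' / Y = A ^ 2 / X" "A + A * A' / X = B ^ 2 / Y"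
    "X - A' ^ 2 / X = B + B * B' / Y" "X + A' ^ 2 / X - A ^ 2 / X = 2 * B'"
    using psiF_degree_15_difference[OF assms(1)] psiF_degree_15_sum[OF assms(1)] theta4_degree_15_difference[OF assms(1)] theta4_degree_15_sum[OF assms(1)]
    unfolding AA' BB' AA BB CC by (simp_all add: A_def B_def B'_def X_def)
  have "(Y / X) * (B / Y) * (B' / Y) * (1 - Y / X) = (A / X) * (A' / X) * (1 + Y / X)"
  proof (rule mixed_modular_algebra)
    show "(A / X) ^ 2 = Y / X * (B / Y) * (1 - B' / Y)" "(A / X) * (1 + A' / X) = Y / X * (B / Y) ^ 2"
      "1 - (A' / X) ^ 2 = Y / X * (B / Y) * (1 + B' / Y)" "1 + (A' / X) ^ 2 - (A / X) ^ 2 = 2 * (Y / X) * (B' / Y)"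
      using eqs pos by (simp_all add: field_simps power2_eq_square)
  qed (use pos in simp_all)
  moreover have "(Y / X) * (B / Y) * (B' / Y) * (1 - Y / X) = (B * B' / Y) * (X - Y) / X ^ 2"
    using pos by (simp add: field_simps power2_eq_square)
  moreover have "(A / X) * (A' / X) * (1 + Y / X) = (A * A' / X) * (X + Y) / X ^ 2"
    using pos by (simp add: field_simps power2_eq_square)
  ultimately have "(B * B' / Y) * (X - Y) / X ^ 2 = (A * A' / X) * (X + Y) / X ^ 2"
    by (simp only:)
  hence "(B * B' / Y) * (X - Y) = (A * A' / X) * (X + Y)"
    unfolding divide_cancel_right using pos by simp
  thus ?thesis
    unfolding AA' [symmetric] BB' [symmetric] by simp
qed

section \<open>Identities of degree 3\<close>

lemma theta_sum_mod_3:
  assumes "y > 0" "\<And>n. \<bar>c n\<bar> \<le> 1" "\<And>n. n \<in> A \<Longrightarrow> c (- n) = c n" "\<And>n. n \<in> A \<Longrightarrow> - n \<in> A"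
  shows "theta_sum c A y = theta_sum c {n \<in> A. n mod 3 = 0} y + 2 * theta_sum c {n \<in> A. n mod 3 = 1} y" (is ?A)
    and "theta_sum c {n \<in> A. n mod 3 = 2} y = theta_sum c {n \<in> A. n mod 3 = 1} y" (is ?B)
proof -
  show B: ?B
    unfolding theta_sum_def
  proof (rule infsum_reindex_bij_witness[where i = uminus and j = uminus])
    fix n assume n: "n \<in> {n \<in> A. n mod 3 = 2}"
    have "n mod 3 = 2 \<Longrightarrow> (- n) mod 3 = 1" by presburger
    thus "- n \<in> {n \<in> A. n mod 3 = 1}"
      using n assms(4) by blast
    show "c (- n) * exp (- (y * (of_int (- n))\<^sup>2)) = c n * exp (- (y * (of_int n)\<^sup>2))"
      using n assms(3) by simp
  next
    fix n assume n: "n \<in> {n \<in> A. n mod 3 = 1}"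
    have "n mod 3 = 1 \<Longrightarrow> (- n) mod 3 = 2" by presburger
    thus "- n \<in> {n \<in> A. n mod 3 = 2}"
      using n assms(4) by blast
  qed simp_all
  have Int: "A \<inter> {n. n mod 3 = 0} = {n \<in> A. n mod 3 = 0}"
    "(A - {n. n mod 3 = 0}) \<inter> {n. n mod 3 = 1} = {n \<in> A. n mod 3 = 1}" by auto
  have "n mod 3 = 0 \<or> n mod 3 = 1 \<or> n mod 3 = 2" for n :: int by presburger
  hence Diff: "A - {n. n mod 3 = 0} - {n. n mod 3 = 1} = {n \<in> A. n mod 3 = 2}" by auto
  have "theta_sum c A y = theta_sum c {n \<in> A. n mod 3 = 0} y + theta_sum c (A - {n. n mod 3 = 0}) y"
    using theta_sum_split[OF assms(1,2), where A = A and P = "{n. n mod 3 = 0}"] unfolding Int .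
  also have "theta_sum c (A - {n. n mod 3 = 0}) y = theta_sum c {n \<in> A. n mod 3 = 1} y + theta_sum c {n \<in> A. n mod 3 = 2} y"
    using theta_sum_split[OF assms(1,2), where A = "A - {n. n mod 3 = 0}" and P = "{n. n mod 3 = 1}"] unfolding Int Diff .
  finally show ?A
    unfolding B by simp
qed

definition chi8_part :: "real \<Rightarrow> int \<Rightarrow> real" where
  "chi8_part x r = theta_sum chi8 {n \<in> {n. odd n}. n mod 3 = r} (pi * x / 8)"

lemma chi8_triple: "odd n \<Longrightarrow> chi8 (3 * n) = - chi8 n"
proof -
  assume "odd n"
  moreover have "(3 * n) mod 8 = (3 * (n mod 8)) mod 8"
    by (simp add: mod_mult_right_eq)
  ultimately show ?thesis
    using odd_mod_8[of n] by (auto simp: chi8_def)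
qed

lemma theta_sum_uminus: "theta_sum (\<lambda>n. - c n) A y = - theta_sum c A y"
  unfolding theta_sum_def mult_minus_left by (rule infsum_uminus)

lemma chi8_part_0: "chi8_part x 0 = - 2 * psiF (9 * x)"
proof -
  have "chi8_part x 0 = theta_sum chi8 {n. 3 dvd n \<and> odd n} (pi * x / 8)"
    unfolding chi8_part_def by (simp add: mod_eq_0_iff_dvd conj_commute)
  also have "\<dots> = theta_sum (\<lambda>n. chi8 (3 * n)) {n. odd (3 * n)} (of_int 3 ^ 2 * (pi * x / 8))"
    by (rule theta_sum_scale) simp
  also have "\<dots> = theta_sum (\<lambda>n. - chi8 n) {n. odd n} (pi * (9 * x) / 8)"
    unfolding theta_sum_def by (intro infsum_cong_neutral) (auto simp: chi8_triple)
  also have "\<dots> = - 2 * psiF (9 * x)"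
    unfolding theta_sum_uminus psiF_def by simp
  finally show ?thesis .
qed

text \<open>Since \<open>chi8 3 = -1\<close>, the multiples of 3 contribute
  \<open>- 2 * psiF (9 * x)\<close>, so removing them adds. By symmetry under negation the residues
  1 and 2 share the rest equally.\<close>

lemma chi8_part_12:
  assumes "x > 0"
  shows "chi8_part x 1 = psiF x + psiF (9 * x)" "chi8_part x 2 = psiF x + psiF (9 * x)"
proof -
  have pos: "pi * x / 8 > 0" using assms by simp
  note parts = theta_sum_mod_3[OF pos, of chi8 "{n. odd n}", folded chi8_part_def]
  have "2 * psiF x = chi8_part x 0 + 2 * chi8_part x 1"
    using parts(1) chi8_uminus by (simp add: psiF_def)
  thus "chi8_part x 1 = psiF x + psiF (9 * x)"
    unfolding chi8_part_0 by simp
  moreover have "chi8_part x 2 = chi8_part x 1"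
    using parts(2) chi8_uminus by simp
  ultimately show "chi8_part x 2 = psiF x + psiF (9 * x)" by simp
qed

text \<open>The shape with \<open>n \<in> UNIV\<close> is that of \<open>theta_sum_mod_3\<close> at
  \<open>A = UNIV\<close>, so that its instances fold.\<close>

definition theta3_part :: "real \<Rightarrow> int \<Rightarrow> real" where
  "theta3_part x r = theta_sum (\<lambda>_. 1) {n \<in> UNIV. n mod 3 = r} (pi * x)"

lemma theta3_part_0: "theta3_part x 0 = theta3 (9 * x)"
proof -
  have "theta3_part x 0 = theta_sum (\<lambda>_. 1) {n. 3 dvd n \<and> True} (pi * x)"
    unfolding theta3_part_def by (simp add: mod_eq_0_iff_dvd)
  also have "\<dots> = theta_sum (\<lambda>_. 1) {n. True} (of_int 3 ^ 2 * (pi * x))"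
    by (rule theta_sum_scale) simp
  finally show ?thesis
    by (simp add: theta3_def mult_ac)
qed

lemma theta3_part_12:
  assumes "x > 0"
  shows "theta3_part x 1 = (theta3 x - theta3 (9 * x)) / 2" "theta3_part x 2 = (theta3 x - theta3 (9 * x)) / 2"
proof -
  have pos: "pi * x > 0" using assms by simp
  note parts = theta_sum_mod_3[OF pos, of "\<lambda>_. 1" UNIV, folded theta3_part_def]
  have "theta3 x = theta3_part x 0 + 2 * theta3_part x 1"
    using parts(1) by (simp add: theta3_def)
  thus "theta3_part x 1 = (theta3 x - theta3 (9 * x)) / 2"
    unfolding theta3_part_0 by simp
  moreover have "theta3_part x 2 = theta3_part x 1"
    using parts(2) by simp
  ultimately show "theta3_part x 2 = (theta3 x - theta3 (9 * x)) / 2" by simp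
qed

lemma infsum_finite_UN:
  fixes f :: "'a \<Rightarrow> real"
  assumes "finite I" "f summable_on (\<Union>i\<in>I. B i)" "\<And>i j. i \<in> I \<Longrightarrow> j \<in> I \<Longrightarrow> i \<noteq> j \<Longrightarrow> B i \<inter> B j = {}"
  shows "infsum f (\<Union>i\<in>I. B i) = (\<Sum>i\<in>I. infsum f (B i))"
proof (rule sum_infsum[symmetric])
  show "f summable_on B i" if "i \<in> I" for i
    by (rule summable_on_subset_banach[OF assms(2)]) (use that in blast)
qed (use assms in auto)

text \<open>
  The involution of the proof multiplies \<open>m + 2 * n * sqrt (-2)\<close> by a quotient of the two primes
  above 3 and conjugates, up to sign. It preserves the norm \<open>m ^ 2 + 8 * n ^ 2\<close> but flips the character, so
  the sum over \<open>S\<close> vanishes.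
\<close>

lemma psiF_theta3_link:
  assumes "x > 0"
  shows "(psiF x + psiF (9 * x)) * (theta3 x - theta3 (9 * x)) = 2 * psiF (9 * x) * theta3 (9 * x)"
proof -
  define y z where "y = pi * x / 8" and "z = pi * x"
  have pos: "y > 0" "z > 0" using assms by (auto simp: y_def z_def)
  define f where "f = (\<lambda>p. chi8 (fst p) * 1 * gauss2 y z p)"
  define B where "B r = {n \<in> {n::int. odd n}. n mod 3 = r} \<times> {n \<in> UNIV. n mod 3 = r}" for r
  define S where "S = {p::int \<times> int. odd (fst p) \<and> fst p mod 3 = snd p mod 3}"
  have B: "infsum f (B r) = chi8_part x r * theta3_part x r" for r
    unfolding f_def B_def chi8_part_def theta3_part_def y_def z_def
    by (rule theta_sum_mult[symmetric]) (use assms in auto)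
  have summ: "f summable_on T" for T
    unfolding f_def by (rule weighted_gauss2_summable[OF pos]) simp
  have "S = (\<Union>r\<in>{0, 1, 2}. B r)"
  proof -
    have "n mod 3 = 0 \<or> n mod 3 = 1 \<or> n mod 3 = 2" for n :: int by presburger
    thus ?thesis unfolding S_def B_def by auto
  qed
  moreover have "infsum f (\<Union>r\<in>{0, 1, 2}. B r) = (\<Sum>r\<in>{0, 1, 2}. infsum f (B r))"
    by (rule infsum_finite_UN) (auto simp: summ B_def)
  ultimately have 1: "infsum f S = (psiF x + psiF (9 * x)) * (theta3 x - theta3 (9 * x)) - 2 * psiF (9 * x) * theta3 (9 * x)"
    using assms by (simp add: B chi8_part_0 chi8_part_12 theta3_part_0 theta3_part_12)
  define i where "i = (\<lambda>p::int \<times> int. ((fst p + 8 * snd p) div 3, (fst p - snd p) div 3))"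
  have i: "i p \<in> S \<and> i (i p) = p \<and> f (i p) = - f p" if "p \<in> S" for p
  proof -
    obtain m n where p: "p = (m, n)" by (cases p)
    have mn: "odd m" "m mod 3 = n mod 3" using that by (auto simp: S_def p)
    define k where "k = (m - n) div 3"
    have m: "m = n + 3 * k"
      unfolding k_def using mn(2) by (metis add_diff_cancel_left' diff_add_cancel dvd_mult_div_cancel mod_eq_dvd_iff)
    have ip: "i p = (3 * n + k, k)"
      unfolding i_def p fst_conv snd_conv m by simp
    have odd: "odd (3 * n + k)" using mn(1) by (simp add: m)
    have "i (i p) = p"
      unfolding ip unfolding i_def p fst_conv snd_conv m by simp
    moreover have "i p \<in> S"
      using odd by (simp add: ip S_def)
    moreover have "f (i p) = - f p"
    proof -
      \<comment> \<open>Three times the new first coordinate is congruent to \<open>m\<close> modulo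
        8, so the character changes by the factor \<open>chi8 3 = -1\<close>.\<close>
      have "chi8 (3 * (3 * n + k)) = chi8 m"
      proof -
        have eq: "3 * (3 * n + k) = m + 8 * n" by (simp add: m)
        show ?thesis unfolding eq by (simp add: chi8_def)
      qed
      hence "chi8 (3 * n + k) = - chi8 m"
        using chi8_triple[OF odd] by simp
      moreover have "gauss2 y z (3 * n + k, k) = gauss2 y z (m, n)"
        unfolding gauss2_def prod.case m y_def z_def by (simp add: power2_eq_square algebra_simps)
      ultimately show ?thesis
        unfolding f_def ip unfolding p by simp
    qed
    ultimately show ?thesis by blast
  qed
  have "infsum f S = infsum (\<lambda>p. - f p) S"
    by (rule infsum_reindex_bij_witness[where i = i and j = i]) (use i in auto)
  hence "infsum f S = 0"
    by (simp add: infsum_uminus)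
  with 1 show ?thesis by simp
qed

section \<open>Fourfold sums and the tetracode\<close>

definition gauss4 :: "real \<Rightarrow> (int \<times> int) \<times> (int \<times> int) \<Rightarrow> real" where
  "gauss4 y = (\<lambda>(p, q). (chi8 (fst p) * chi8 (snd p) * gauss2 y y p) * (chi8 (fst q) * chi8 (snd q) * gauss2 y y q))"

lemma gauss4_summable:
  assumes "y > 0"
  shows "gauss4 y summable_on S"
proof -
  have "(\<lambda>p. chi8 (fst p) * chi8 (snd p) * gauss2 y y p) summable_on UNIV"
    by (rule weighted_gauss2_summable[OF assms assms]) (simp add: abs_mult)
  from summable_on_real_product[OF this this] have "gauss4 y summable_on UNIV"
    by (simp add: gauss4_def)
  thus ?thesis
    by (rule summable_on_subset_banach) simp
qed

lemma theta_sum_mult4: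
  assumes "y > 0"
  shows "theta_sum chi8 A y * theta_sum chi8 B y * (theta_sum chi8 C y * theta_sum chi8 D y) =
    infsum (gauss4 y) ((A \<times> B) \<times> (C \<times> D))"
proof -
  have summ: "(\<lambda>p. chi8 (fst p) * chi8 (snd p) * gauss2 y y p) summable_on T" for T
    by (rule weighted_gauss2_summable[OF assms assms]) (simp add: abs_mult)
  show ?thesis
    using infsum_real_product[OF summ summ, of "A \<times> B" "C \<times> D"] assms
    unfolding gauss4_def by (simp add: theta_sum_mult)
qed

lemma chi8_square:
  assumes "odd n"
  shows "n ^ 2 mod 16 = (if chi8 n = 1 then 1 else 9)"
proof -
  obtain k where n: "n = 8 * k + n mod 8"
    by (metis mult_div_mod_eq)
  define r where "r = n mod 8"
  have "n ^ 2 = r ^ 2 + 16 * (4 * k ^ 2 + k * r)"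
    unfolding n[folded r_def] by (simp add: power2_eq_square algebra_simps)
  hence "n ^ 2 mod 16 = r ^ 2 mod 16" by (simp only: mod_mult_self2)
  thus ?thesis
    using odd_mod_8[OF assms] unfolding chi8_def r_def by auto
qed

text \<open>An odd square is 1 or 9 modulo 16 according to the character, so each factor -1 adds 8
  to the sum 4 of four such squares.\<close>

lemma chi8_mult4:
  assumes "odd a" "odd b" "odd c" "odd d"
  shows "chi8 a * chi8 b * (chi8 c * chi8 d) = (if (a ^ 2 + b ^ 2 + (c ^ 2 + d ^ 2)) mod 16 = 4 then 1 else -1)"
proof -
  have *: "(a ^ 2 + b ^ 2 + (c ^ 2 + d ^ 2)) mod 16 = (a ^ 2 mod 16 + b ^ 2 mod 16 + (c ^ 2 mod 16 + d ^ 2 mod 16)) mod 16"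
    by (intro mod_add_cong) simp_all
  have pm: "chi8 n = 1 \<or> chi8 n = -1" for n by (simp add: chi8_def)
  show ?thesis
    unfolding * chi8_square[OF assms(1)] chi8_square[OF assms(2)] chi8_square[OF assms(3)] chi8_square[OF assms(4)]
    using pm[of a] pm[of b] pm[of c] pm[of d] by (elim disjE) simp_all
qed

lemma sum_odd_squares_mod_16:
  assumes "odd a" "odd b" "odd c" "odd (d::int)"
  shows "(a ^ 2 + b ^ 2 + (c ^ 2 + d ^ 2)) mod 16 = 4 \<or> (a ^ 2 + b ^ 2 + (c ^ 2 + d ^ 2)) mod 16 = 12"
proof -
  have *: "(a ^ 2 + b ^ 2 + (c ^ 2 + d ^ 2)) mod 16 = (a ^ 2 mod 16 + b ^ 2 mod 16 + (c ^ 2 mod 16 + d ^ 2 mod 16)) mod 16"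
    by (intro mod_add_cong) simp_all
  show ?thesis
    unfolding * chi8_square[OF assms(1)] chi8_square[OF assms(2)] chi8_square[OF assms(3)] chi8_square[OF assms(4)]
    by simp
qed

definition odd_class :: "int \<Rightarrow> int set" where
  "odd_class r = {n \<in> {n. odd n}. n mod 3 = r}"

lemma mod_3_cases: "n mod 3 \<in> {0, 1, 2 :: int}"
proof -
  have "n mod 3 = 0 \<or> n mod 3 = 1 \<or> n mod 3 = 2" by presburger
  thus ?thesis by simp
qed

text \<open>The odd vectors that reduce modulo 3 to the tetracode, the self-dual ternary code of
  length 4 with words (a, b, b - a, a + b).\<close>

definition tetracode_lattice :: "((int \<times> int) \<times> (int \<times> int)) set" where
  "tetracode_lattice = {((a, b), (c, d)). odd a \<and> odd b \<and> odd c \<and> odd d \<and>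
     c mod 3 = (b mod 3 - a mod 3) mod 3 \<and> d mod 3 = (a mod 3 + b mod 3) mod 3}"

lemma infsum_tetracode_lattice:
  assumes "x > 0"
  shows "infsum (gauss4 (pi * x / 8)) tetracode_lattice =
    16 * psiF (9 * x) ^ 4 - 16 * psiF (9 * x) * (psiF x + psiF (9 * x)) ^ 3"
proof -
  define y where "y = pi * x / 8"
  have y: "y > 0" using assms by (simp add: y_def)
  define B where "B = (\<lambda>(r, s). (odd_class r \<times> odd_class s) \<times> (odd_class ((s - r) mod 3) \<times> odd_class ((r + s) mod 3)))"
  define I where "I = {0, 1, 2::int} \<times> {0, 1, 2::int}"
  have B: "infsum (gauss4 y) (B (r, s)) =
      chi8_part x r * chi8_part x s * (chi8_part x ((s - r) mod 3) * chi8_part x ((r + s) mod 3))" for r s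
    unfolding B_def prod.case chi8_part_def y_def [symmetric] odd_class_def [symmetric]
    by (rule theta_sum_mult4[OF y, symmetric])
  have memB: "((a, b), (c, d)) \<in> B (r, s) \<longleftrightarrow> odd a \<and> odd b \<and> odd c \<and> odd d \<and>
      r = a mod 3 \<and> s = b mod 3 \<and> c mod 3 = (b mod 3 - a mod 3) mod 3 \<and> d mod 3 = (a mod 3 + b mod 3) mod 3"
    for a b c d r s
    unfolding B_def odd_class_def by auto
  have L: "tetracode_lattice = (\<Union>i\<in>I. B i)"
  proof (rule set_eqI)
    fix w :: "(int \<times> int) \<times> (int \<times> int)"
    obtain a b c d where w: "w = ((a, b), (c, d))" by (metis surj_pair)
    have "(a mod 3, b mod 3) \<in> I" unfolding I_def by (intro SigmaI mod_3_cases)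
    moreover have "i = (a mod 3, b mod 3)" if "w \<in> B i" for i
      using that unfolding w by (cases i) (simp add: memB)
    ultimately have "w \<in> (\<Union>i\<in>I. B i) \<longleftrightarrow> w \<in> B (a mod 3, b mod 3)"
      by blast
    thus "w \<in> tetracode_lattice \<longleftrightarrow> w \<in> (\<Union>i\<in>I. B i)"
      unfolding w memB tetracode_lattice_def by simp
  qed
  have disj: "B i \<inter> B j = {}" if "i \<noteq> j" for i j
  proof (rule equals0I)
    fix w assume "w \<in> B i \<inter> B j"
    moreover obtain a b c d where "w = ((a, b), (c, d))" by (metis surj_pair)
    moreover obtain r s r' s' where "i = (r, s)" "j = (r', s')" by (metis surj_pair)
    ultimately show False
      using that by (simp add: memB)
  qed
  have "infsum (gauss4 y) tetracode_lattice = (\<Sum>i\<in>I. infsum (gauss4 y) (B i))"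
    unfolding L by (rule infsum_finite_UN[OF _ gauss4_summable[OF y]]) (use disj in \<open>simp_all add: I_def\<close>)
  also have "\<dots> = (\<Sum>r\<in>{0, 1, 2}. \<Sum>s\<in>{0, 1, 2}. infsum (gauss4 y) (B (r, s)))"
    unfolding I_def by (simp only: sum.cartesian_product case_prod_unfold prod.collapse)
  \<comment> \<open>Each of the eight nonzero codewords has exactly one zero coordinate, and the
    residues 1 and 2 contribute equally.\<close>
  also have "\<dots> = chi8_part x 0 ^ 4 + 8 * (chi8_part x 0 * chi8_part x 1 ^ 3)"
  proof -
    have "chi8_part x 2 = chi8_part x 1"
      using chi8_part_12[OF assms] by simp
    thus ?thesis
      unfolding B by (simp add: power4_eq_xxxx power3_eq_cube)
  qed
  also have "\<dots> = 16 * psiF (9 * x) ^ 4 - 16 * psiF (9 * x) * (psiF x + psiF (9 * x)) ^ 3"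
    unfolding chi8_part_0 chi8_part_12[OF assms] by (simp add: power_mult_distrib)
  finally show ?thesis unfolding y_def .
qed

lemma infsum_gauss4_odd:
  assumes "x > 0"
  shows "infsum (gauss4 (3 * (pi * x / 8))) (({n. odd n} \<times> {n. odd n}) \<times> ({n. odd n} \<times> {n. odd n})) = 16 * psiF (3 * x) ^ 4"
proof -
  define y where "y = pi * x / 8"
  have y: "3 * y > 0" using assms by (simp add: y_def)
  have "2 * psiF (3 * x) = theta_sum chi8 {n. odd n} (3 * y)"
    by (simp add: psiF_def y_def mult_ac)
  hence "infsum (gauss4 (3 * y)) (({n. odd n} \<times> {n. odd n}) \<times> ({n. odd n} \<times> {n. odd n})) =
      (2 * psiF (3 * x)) * (2 * psiF (3 * x)) * ((2 * psiF (3 * x)) * (2 * psiF (3 * x)))"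
    using theta_sum_mult4[OF y, of "{n. odd n}" "{n. odd n}" "{n. odd n}" "{n. odd n}"] by simp
  also have "\<dots> = 16 * psiF (3 * x) ^ 4"
    by (simp add: power4_eq_xxxx)
  finally show ?thesis unfolding y_def .
qed

lemma gauss4_expand:
  "gauss4 t ((a, b), (c, d)) = (chi8 a * chi8 b * (chi8 c * chi8 d)) * exp (- (t * of_int (a ^ 2 + b ^ 2 + (c ^ 2 + d ^ 2))))"
proof -
  have "- (t * real_of_int (a ^ 2 + b ^ 2 + (c ^ 2 + d ^ 2))) =
    - (t * of_int a ^ 2 + t * of_int b ^ 2) + - (t * of_int c ^ 2 + t * of_int d ^ 2)"
    by (simp add: algebra_simps)
  hence "exp (- (t * real_of_int (a ^ 2 + b ^ 2 + (c ^ 2 + d ^ 2)))) =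
    exp (- (t * of_int a ^ 2 + t * of_int b ^ 2)) * exp (- (t * of_int c ^ 2 + t * of_int d ^ 2))"
    by (simp only: exp_add)
  thus ?thesis
    unfolding gauss4_def gauss2_def prod.case fst_conv snd_conv by (simp only: mult_ac)
qed

text \<open>
  The matrix of \<open>j\<close> is a conference matrix of order 4, so \<open>j\<close> triples the sum of the squares.
  This sum is 4 or 12 modulo 16 and determines the product of the four characters, which is
  therefore flipped.
\<close>

lemma infsum_tetracode_rotate:
  "infsum (gauss4 y) tetracode_lattice =
   infsum (\<lambda>w. - gauss4 (3 * y) w) (({n. odd n} \<times> {n. odd n}) \<times> ({n. odd n} \<times> {n. odd n}))"
proof -
  define j where "j = (\<lambda>((a, b), (c, d)). ((b + c + d, c - d - a), (d - a - b, b - a - c :: int)))"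
  \<comment> \<open>The matrix of \<open>j\<close> is skew with square -3, so its inverse is the
    same matrix divided by -3. The divisions are exact on the tetracode lattice.\<close>
  define i where "i = (\<lambda>((a, b), (c, d)). ((- ((b + c + d) div 3), (a - c + d) div 3), ((a + b - d) div 3, (a - b + c) div 3 :: int)))"
  let ?Odd = "{n::int. odd n}"
  have j: "i (j w) = w \<and> j w \<in> tetracode_lattice \<and> gauss4 y (j w) = - gauss4 (3 * y) w"
    if "w \<in> (?Odd \<times> ?Odd) \<times> (?Odd \<times> ?Odd)" for w
  proof -
    obtain a b c d where w: "w = ((a, b), (c, d))" by (metis surj_pair)
    have odd: "odd a" "odd b" "odd c" "odd d"
      using that by (simp_all add: w)
    have jw: "j ((a, b), (c, d)) = ((b + c + d, c - d - a), (d - a - b, b - a - c))"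
      by (simp add: j_def)
    have "i (j w) = w"
      unfolding w jw i_def by simp
    moreover have odd': "odd (b + c + d)" "odd (c - d - a)" "odd (d - a - b)" "odd (b - a - c)"
      using odd by simp_all
    moreover have "j w \<in> tetracode_lattice"
    proof -
      have "d - a - b = (c - d - a - (b + c + d)) + 3 * d" "b - a - c = (b + c + d + (c - d - a)) + 3 * (- c)"
        by simp_all
      hence "(d - a - b) mod 3 = (c - d - a - (b + c + d)) mod 3" "(b - a - c) mod 3 = (b + c + d + (c - d - a)) mod 3"
        by (metis mod_mult_self2)+
      hence "(d - a - b) mod 3 = ((c - d - a) mod 3 - (b + c + d) mod 3) mod 3"
        "(b - a - c) mod 3 = ((b + c + d) mod 3 + (c - d - a) mod 3) mod 3"
        by (simp_all only: mod_diff_eq mod_add_eq)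
      thus ?thesis
        unfolding w jw tetracode_lattice_def mem_Collect_eq prod.case using odd' by (intro conjI)
    qed
    moreover have "gauss4 y (j w) = - gauss4 (3 * y) w"
    proof -
      define N where "N = a ^ 2 + b ^ 2 + (c ^ 2 + d ^ 2)"
      have N3: "(b + c + d) ^ 2 + (c - d - a) ^ 2 + ((d - a - b) ^ 2 + (b - a - c) ^ 2) = 3 * N"
        by (simp add: N_def power2_eq_square algebra_simps)
      have "(3 * N) mod 16 = 4 \<longleftrightarrow> N mod 16 \<noteq> 4"
      proof -
        have "N mod 16 = 4 \<or> N mod 16 = 12"
          unfolding N_def by (rule sum_odd_squares_mod_16[OF odd])
        moreover have "(3 * N) mod 16 = (3 * (N mod 16)) mod 16"
          by (rule mod_mult_right_eq[symmetric])
        ultimately show ?thesis by (elim disjE) simp_all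
      qed
      hence chi: "chi8 (b + c + d) * chi8 (c - d - a) * (chi8 (d - a - b) * chi8 (b - a - c)) =
          - (chi8 a * chi8 b * (chi8 c * chi8 d))"
        unfolding chi8_mult4[OF odd] chi8_mult4[OF odd'] N3 N_def [symmetric] by simp
      show ?thesis
        unfolding w jw gauss4_expand chi N3 N_def [symmetric] by simp
    qed
    ultimately show ?thesis by (intro conjI)
  qed
  have i: "j (i w) = w \<and> i w \<in> (?Odd \<times> ?Odd) \<times> (?Odd \<times> ?Odd)" if "w \<in> tetracode_lattice" for w
  proof -
    obtain a b c d where w: "w = ((a, b), (c, d))" by (metis surj_pair)
    have odd: "odd a" "odd b" "odd c" "odd d"
      and mod: "c mod 3 = (b mod 3 - a mod 3) mod 3" "d mod 3 = (a mod 3 + b mod 3) mod 3"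
      using that by (simp_all add: w tetracode_lattice_def)
    define k l where "k = (c - (b - a)) div 3" and "l = (d - (a + b)) div 3"
    have "3 dvd c - (b - a)" "3 dvd d - (a + b)"
      using mod unfolding mod_diff_eq mod_add_eq mod_eq_dvd_iff by blast+
    hence cd: "c = b - a + 3 * k" "d = a + b + 3 * l"
      by (simp_all add: k_def l_def)
    have "b + c + d = 3 * (b + k + l)" "a - c + d = 3 * (a - k + l)" "a + b - d = 3 * (- l)" "a - b + c = 3 * k"
      unfolding cd by simp_all
    hence div: "(b + c + d) div 3 = b + k + l" "(a - c + d) div 3 = a - k + l"
        "(a + b - d) div 3 = - l" "(a - b + c) div 3 = k"
      by simp_all
    have iw: "i w = ((- (b + k + l), a - k + l), (- l, k))"
      unfolding w i_def prod.case div ..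
    \<comment> \<open>As \<open>c\<close> is odd and b - a is even, 3k must be odd; likewise for
      \<open>l\<close>.\<close>
    have "odd k" "odd l" "odd (b + k + l)" "odd (a - k + l)"
      using odd unfolding cd by simp_all
    thus ?thesis
      unfolding iw unfolding w j_def prod.case cd by simp
  qed
  show ?thesis
  proof (rule infsum_reindex_bij_witness[symmetric, where i = i and j = j])
    fix w assume "w \<in> (?Odd \<times> ?Odd) \<times> (?Odd \<times> ?Odd)"
    note jw = j[OF this]
    show "i (j w) = w" "j w \<in> tetracode_lattice" "gauss4 y (j w) = - gauss4 (3 * y) w"
      by (rule jw[THEN conjunct1], rule jw[THEN conjunct2, THEN conjunct1], rule jw[THEN conjunct2, THEN conjunct2])
  next
    fix w assume "w \<in> tetracode_lattice"
    note iw = i[OF this]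
    show "j (i w) = w" "i w \<in> (?Odd \<times> ?Odd) \<times> (?Odd \<times> ?Odd)"
      by (rule iw[THEN conjunct1], rule iw[THEN conjunct2])
  qed
qed

text \<open>The tetracode sum is computed twice: by codewords, and by rotating it to the sum over
  all odd vectors at three times the scale, with the opposite sign.\<close>

lemma psiF_cubic:
  assumes "x > 0"
  shows "(psiF x + psiF (9 * x)) ^ 3 * psiF (9 * x) = psiF (3 * x) ^ 4 + psiF (9 * x) ^ 4"
proof -
  have "16 * psiF (9 * x) ^ 4 - 16 * psiF (9 * x) * (psiF x + psiF (9 * x)) ^ 3 = - (16 * psiF (3 * x) ^ 4)"
    unfolding infsum_tetracode_lattice[OF assms, symmetric] infsum_gauss4_odd[OF assms, symmetric]
      infsum_tetracode_rotate infsum_uminus ..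
  thus ?thesis by (simp add: algebra_simps)
qed

section \<open>The evaluations\<close>

text \<open>\<open>e\<close> is one eighth of \<open>b - a\<close>, the quotient of the two
  prefactors. \<open>P\<close>, \<open>E\<close>, \<open>Q\<close> are free variables so that every
  way of writing the exponents matches.\<close>

lemma psi_ratio:
  assumes "a > 0" "b > 0" "a + 8 * e = b" "P = - (pi * a)" "E = - (pi * e)" "Q = - (pi * b)"
  shows "psi (- exp P) / (exp E * psi (- exp Q)) = psiF a / psiF b"
proof -
  have E: "exp E = exp (pi * a / 8) / exp (pi * b / 8)"
    unfolding exp_diff [symmetric] assms(5) assms(3) [symmetric] by (simp add: algebra_simps)
  define p q where "p = psi (- exp P)" and "q = psi (- exp Q)"
  have "psiF a = p / exp (pi * a / 8)" "psiF b = q / exp (pi * b / 8)"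
    unfolding psiF_eq_psi[OF assms(1)] psiF_eq_psi[OF assms(2)] p_def q_def assms(4,6)
    by (simp_all add: exp_minus field_simps)
  thus ?thesis
    unfolding p_def [symmetric] q_def [symmetric] E by simp
qed

lemma sqrt_sqrt_eq_root_4: "sqrt (sqrt x) = root 4 x"
  using real_root_mult_exp[of 2 2 x] by (simp add: sqrt_def)

lemma psi_theta3_sqrt_5_system:
  fixes u v :: real
  assumes "u * (sqrt 3 - v) = sqrt 3 * (sqrt 3 + v)" "(u + 1) * (v - 1) = 2" "u > 0"
  shows "u = sqrt 3 * (sqrt 3 + 1) * (sqrt 5 + sqrt 3) / 2"
proof -
  have s: "sqrt 3 * sqrt 3 = (3::real)" "sqrt 5 * sqrt 5 = (5::real)" by simp_all
  have v: "(u + 1) * v = u + 3"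
    using assms(2) by (simp add: algebra_simps)
  have "u * (sqrt 3 * (u + 1) - (u + 1) * v) = sqrt 3 * (sqrt 3 * (u + 1) + (u + 1) * v)"
    using arg_cong[OF assms(1), of "\<lambda>t. (u + 1) * t"] by (simp only: algebra_simps)
  hence "u * (sqrt 3 * (u + 1) - (u + 3)) = sqrt 3 * (sqrt 3 * (u + 1) + (u + 3))"
    unfolding v .
  hence quad: "(sqrt 3 - 1) * u ^ 2 - 6 * u = 3 * (sqrt 3 + 1)"
    using s(1) by (simp add: algebra_simps power2_eq_square)
  \<comment> \<open>Scaling makes the quadratic rational: w^2 - 6w = 6, with roots 3 plus or minus
    \<open>sqrt 15\<close>, of which one is positive.\<close>
  define w where "w = (sqrt 3 - 1) * u"
  have "sqrt 3 > (1::real)" by simp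
  hence w: "w > 0" using assms(3) by (simp add: w_def)
  have "w ^ 2 - 6 * w = (sqrt 3 - 1) * ((sqrt 3 - 1) * u ^ 2 - 6 * u)"
    by (simp add: w_def power2_eq_square algebra_simps)
  also have "\<dots> = 6"
    unfolding quad using s(1) by (simp add: algebra_simps)
  finally have "(w - 3 - sqrt 3 * sqrt 5) * (w - 3 + sqrt 3 * sqrt 5) = 0"
    using s by (simp add: algebra_simps power2_eq_square)
  moreover have "sqrt 3 * sqrt 5 > (3::real)"
  proof -
    have "sqrt 3 * sqrt 5 = sqrt (15::real)" by (simp flip: real_sqrt_mult)
    moreover have "3 < sqrt (15::real)" by (rule real_less_rsqrt) simp
    ultimately show ?thesis by simp
  qed
  ultimately have "w = 3 + sqrt 3 * sqrt 5"
    using w by auto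
  moreover have "2 * u = (sqrt 3 + 1) * w"
    using s(1) by (simp add: w_def algebra_simps)
  ultimately have "2 * u = sqrt 3 * (sqrt 3 + 1) * (sqrt 5 + sqrt 3)"
    using s(1) by (simp add: algebra_simps)
  thus ?thesis by simp
qed

lemma psiF_sqrt_5:
  "psiF (sqrt 5 / 3) / psiF (3 * sqrt 5) = sqrt 3 * (sqrt 3 + 1) * (sqrt 5 + sqrt 3) / 2"
proof (rule psi_theta3_sqrt_5_system)
  define f g p q where "f = psiF (sqrt 5 / 3)" and "g = psiF (3 * sqrt 5)"
    and "p = theta3 (sqrt 5 / 3)" and "q = theta3 (3 * sqrt 5)"
  define t where "t = sqrt (sqrt 5 / 3)"
  have pos: "f > 0" "g > 0" "p > 0" "q > 0" "t > 0" "psiF (sqrt 5) > 0" "theta3 (sqrt 5) > 0"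
    by (simp_all add: f_def g_def p_def q_def t_def psiF_pos theta3_pos)
  have t3: "sqrt (sqrt 5) = sqrt 3 * t"
    by (simp add: t_def real_sqrt_divide)
  \<comment> \<open>Inversion sends \<open>1 / sqrt 5\<close> to \<open>sqrt 5\<close>, already
    among the four arguments, so the values at \<open>sqrt 5\<close> cancel. It sends
    \<open>3 / sqrt 5\<close> to \<open>sqrt 5 / 3\<close>, a ninth of the fourth argument
    \<open>3 * sqrt 5\<close>, where \<open>psiF_theta3_link\<close> applies.\<close>
  have arg: "3 * (1 / sqrt 5) = 1 / (sqrt 5 / 3)" "5 * (1 / sqrt 5) = sqrt 5" "15 * (1 / sqrt 5) = 3 * sqrt 5"
    by (simp_all add: field_simps)
  have inv: "psiF (1 / (sqrt 5 / 3)) = t * f" "theta3 (1 / (sqrt 5 / 3)) = t * p"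
    "psiF (1 / sqrt 5) = sqrt 3 * t * psiF (sqrt 5)" "theta3 (1 / sqrt 5) = sqrt 3 * t * theta3 (sqrt 5)"
    unfolding f_def p_def t3 [symmetric] unfolding t_def by (intro psiF_inversion theta3_inversion; simp)+
  have "t * f * psiF (sqrt 5) * (sqrt 3 * t * theta3 (sqrt 5) * q - t * p * theta3 (sqrt 5)) =
      sqrt 3 * t * psiF (sqrt 5) * g * (sqrt 3 * t * theta3 (sqrt 5) * q + t * p * theta3 (sqrt 5))"
    using psiF_degree_15[of "1 / sqrt 5"] unfolding arg inv g_def [symmetric] q_def [symmetric] by simp
  hence "(t * psiF (sqrt 5) * t * theta3 (sqrt 5)) * (f * (sqrt 3 * q - p)) =
         (t * psiF (sqrt 5) * t * theta3 (sqrt 5)) * (sqrt 3 * g * (sqrt 3 * q + p))"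
    by (simp only: algebra_simps)
  hence "f * (sqrt 3 * q - p) = sqrt 3 * g * (sqrt 3 * q + p)"
    using pos by simp
  hence "f * (sqrt 3 * q - p) / (g * q) = sqrt 3 * g * (sqrt 3 * q + p) / (g * q)"
    by (simp only:)
  thus "f / g * (sqrt 3 - p / q) = sqrt 3 * (sqrt 3 + p / q)"
    using pos by (simp add: diff_divide_distrib add_divide_distrib right_diff_distrib distrib_left)
  have "(f + g) * (p - q) = 2 * g * q"
    using psiF_theta3_link[of "sqrt 5 / 3"] by (simp add: f_def g_def p_def q_def)
  thus "(f / g + 1) * (p / q - 1) = 2"
    using pos by (simp add: field_simps)
  show "f / g > 0" using pos by simp
qed

text \<open>At \<open>x = 1 / 3\<close> inversion ties the two outer arguments together, and the
  cubic identity is linear in \<open>psiF 1 ^ 4\<close>.\<close>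

lemma psiF_1_3: "(psiF 1 / psiF 3) ^ 4 = 3 * sqrt 3 * (2 + sqrt 3)"
proof -
  have pos: "psiF 1 > 0" "psiF 3 > 0" by (simp_all add: psiF_pos)
  have "psiF (1 / 3) = sqrt 3 * psiF 3"
    by (rule psiF_inversion) simp
  hence "((sqrt 3 + 1) * psiF 3) ^ 3 * psiF 3 = psiF 1 ^ 4 + psiF 3 ^ 4"
    using psiF_cubic[of "1 / 3"] by (simp add: distrib_right)
  moreover have "((sqrt 3 + 1) * psiF 3) ^ 3 * psiF 3 = (sqrt 3 + 1) ^ 3 * psiF 3 ^ 4"
    by (simp add: power_mult_distrib power4_eq_xxxx power3_eq_cube)
  ultimately have "psiF 1 ^ 4 = ((sqrt 3 + 1) ^ 3 - 1) * psiF 3 ^ 4"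
    by (simp add: left_diff_distrib)
  moreover have "(sqrt 3 + 1) ^ 3 - 1 = 3 * sqrt 3 * (2 + sqrt 3)"
    by (simp add: power3_eq_cube algebra_simps)
  ultimately show ?thesis
    using pos by (simp add: power_divide)
qed

lemma psiF_sqrt_3: "3 * psiF (3 * sqrt 3) / psiF (1 / sqrt 3) = root 3 4 - 1"
proof -
  define f g h where "f = psiF (1 / sqrt 3)" and "g = psiF (3 * sqrt 3)" and "h = psiF (sqrt 3)"
  have pos: "f > 0" "g > 0" "h > 0" by (simp_all add: f_def g_def h_def psiF_pos)
  have "f = root 4 3 * h"
    unfolding f_def h_def sqrt_sqrt_eq_root_4 [symmetric] by (rule psiF_inversion) simp
  hence f4: "f ^ 4 = 3 * h ^ 4"
    by (simp add: power_mult_distrib)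
  have arg: "9 * (1 / sqrt 3) = 3 * sqrt 3" "3 * (1 / sqrt 3) = sqrt 3"
    by (simp_all add: field_simps)
  have "(f + g) ^ 3 * g = h ^ 4 + g ^ 4"
    unfolding f_def g_def h_def using psiF_cubic[of "1 / sqrt 3", unfolded arg] by simp
  hence "3 * (f + g) ^ 3 * g = f ^ 4 + 3 * g ^ 4"
    unfolding f4 by simp
  \<comment> \<open>The terms \<open>3 * g ^ 4\<close> cancel, so a factor \<open>f\<close> splits
    off and a cubic remains.\<close>
  hence "f * (f ^ 3) = f * (3 * (f ^ 2 * g + 3 * f * g ^ 2 + 3 * g ^ 3))"
    by (simp add: power_numeral_reduce algebra_simps)
  hence "f ^ 3 = 3 * (f ^ 2 * g + 3 * f * g ^ 2 + 3 * g ^ 3)"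
    using pos by simp
  \<comment> \<open>The cubic completes to a pure cube; this is the origin of
    \<open>root 3 4\<close>.\<close>
  hence "(3 * g + f) ^ 3 = 4 * f ^ 3"
    by (simp add: power_numeral_reduce algebra_simps)
  moreover have "3 * g / f + 1 = (3 * g + f) / f"
    using pos by (simp add: field_simps)
  ultimately have "(3 * g / f + 1) ^ 3 = 4"
    using pos by (simp add: power_divide)
  hence "root 3 4 = 3 * g / f + 1"
    using pos by (intro real_root_pos_unique) auto
  thus ?thesis by (simp add: f_def g_def)
qed

theorem theorem5p4:
  shows "(psi (- exp (- pi / sqrt 5)) / (exp (- pi / (2 * sqrt 5)) * psi (- exp (- sqrt 5 * pi)))
     = root 4 5)
  \<and> (psi (- exp (- 3 * pi / sqrt 5)) / (exp (- 3 * pi / (2 * sqrt 5)) * psi (- exp (- 3 * sqrt 5 * pi)))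
     = root 4 5 * (sqrt 3 + 1) * (sqrt 5 + sqrt 3) / 2)
  \<and> (psi (- exp (- pi / (3 * sqrt 5))) / (exp (- pi / (3 * sqrt 5)) * psi (- exp (- 3 * pi / sqrt 5)))
     = sqrt 3 * (sqrt 3 - 1) * (sqrt 5 - sqrt 3) / 2)
  \<and> (psi (- exp (- pi / (3 * sqrt 3))) / (exp (- pi / (12 * sqrt 3)) * psi (- exp (- pi / sqrt 3)))
     = 3 powr (- 1 / 4) * (root 3 4 - 1))
  \<and> (psi (- exp (- pi)) / (exp (- pi / 4) * psi (- exp (- 3 * pi)))
     = root 4 (3 * sqrt 3 * (2 + sqrt 3)))
  \<and> (psi (- exp (- pi / (3 * sqrt 5))) / (exp (- pi / (6 * sqrt 5)) * psi (- exp (- sqrt 5 * pi / 3)))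
     = root 4 5 * (sqrt 3 - 1) * (sqrt 5 - sqrt 3) / 2)
  \<and> (psi (- exp (- sqrt 5 * pi / 3)) / (exp (- sqrt 5 * pi / 3) * psi (- exp (- 3 * sqrt 5 * pi)))
     = sqrt 3 * (sqrt 3 + 1) * (sqrt 5 + sqrt 3) / 2)
  \<and> (psi (- exp (- pi / sqrt 3)) / (exp (- pi / (4 * sqrt 3)) * psi (- exp (- sqrt 3 * pi)))
     = root 4 3)
  \<and> (psi (- exp (- sqrt 3 * pi)) / (exp (- sqrt 3 * pi / 4) * psi (- exp (- 3 * sqrt 3 * pi)))
     = root 4 27 / (root 3 4 - 1))
  \<and> (psi (- exp (- pi / 3)) / (exp (- pi / 3) * psi (- exp (- 3 * pi)))
     = sqrt 3)
  \<and> (psi (- exp (- pi / 3)) / (exp (- pi / 12) * psi (- exp (- pi)))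
     = root 4 (sqrt 3 * (2 - sqrt 3)))
  \<and> (psi (- exp (- pi / sqrt 3)) / (exp (- pi / sqrt 3) * psi (- exp (- 3 * sqrt 3 * pi)))
     = 3 / (root 3 4 - 1))
  \<and> (psi (- exp (- pi / (3 * sqrt 3))) / (exp (- pi / (3 * sqrt 3)) * psi (- exp (- sqrt 3 * pi)))
     = root 3 4 - 1)"
proof -
  have s: "sqrt 3 * sqrt 3 = (3::real)" "sqrt 5 * sqrt 5 = (5::real)" by simp_all
  have pos: "psiF (sqrt 5) > 0" "psiF (sqrt 5 / 3) > 0" "psiF (3 * sqrt 5) > 0" "psiF (sqrt 3) > 0" "psiF (3 * sqrt 3) > 0"
     "psiF (1 / sqrt 3) > 0" "psiF 1 > 0" "psiF 3 > 0"
    by (simp_all add: psiF_pos)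
  have root5: "sqrt (sqrt 5) = root 4 5" "sqrt (sqrt 5 / 3) = root 4 5 / sqrt 3" "sqrt (3 * sqrt 5) = sqrt 3 * root 4 5"
    by (simp_all add: real_sqrt_divide real_sqrt_mult sqrt_sqrt_eq_root_4)
  have root3: "sqrt (sqrt 3) = root 4 3" "sqrt (3 * sqrt 3) = root 4 27"
  proof -
    show "sqrt (sqrt 3) = root 4 3" by (rule sqrt_sqrt_eq_root_4)
    have "3 * sqrt 3 = sqrt 27"
      using real_sqrt_mult[of 9 3] by simp
    thus "sqrt (3 * sqrt 3) = root 4 27"
      by (simp add: sqrt_sqrt_eq_root_4)
  qed
  have root3': "root 4 3 * root 4 27 = 3"
  proof -
    have "root 4 3 * root 4 27 = root 4 (3 ^ 4 :: real)"
      unfolding real_root_mult [symmetric] by simp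
    thus ?thesis
      by (simp only: real_root_power_cancel)
  qed
  have inv5: "psiF (1 / sqrt 5) = root 4 5 * psiF (sqrt 5)"
    "psiF (1 / (sqrt 5 / 3)) = root 4 5 / sqrt 3 * psiF (sqrt 5 / 3)"
    "psiF (1 / (3 * sqrt 5)) = sqrt 3 * root 4 5 * psiF (3 * sqrt 5)"
    using psiF_inversion[of "sqrt 5"] psiF_inversion[of "sqrt 5 / 3"] psiF_inversion[of "3 * sqrt 5"]
    unfolding root5 by simp_all
  have inv3: "psiF (1 / sqrt 3) = root 4 3 * psiF (sqrt 3)"
    "psiF (1 / (3 * sqrt 3)) = root 4 27 * psiF (3 * sqrt 3)"
    unfolding root3 [symmetric] by (intro psiF_inversion; simp)+
  have inv1: "psiF (1 / 3) = sqrt 3 * psiF 3"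
    by (rule psiF_inversion) simp
  \<comment> \<open>Inversion reduces all five evaluations with \<open>sqrt 5\<close> to this ratio;
    the first needs inversion alone.\<close>
  define u where "u = sqrt 3 * (sqrt 3 + 1) * (sqrt 5 + sqrt 3) / 2"
  have ratio: "psiF (sqrt 5 / 3) / psiF (3 * sqrt 5) = u"
    unfolding u_def by (rule psiF_sqrt_5)
  have u: "psiF (sqrt 5 / 3) = u * psiF (3 * sqrt 5)" "u > 0"
    unfolding ratio [symmetric] using pos by simp_all
  have u_inv: "sqrt 3 / u = (sqrt 3 - 1) * (sqrt 5 - sqrt 3) / 2"
  proof -
    have prods: "(sqrt 3 - 1) * (sqrt 3 + 1) = (2::real)" "(sqrt 5 - sqrt 3) * (sqrt 5 + sqrt 3) = (2::real)"
      using s by (simp_all add: algebra_simps)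
    have "(sqrt 3 - 1) * (sqrt 5 - sqrt 3) / 2 * u =
        sqrt 3 * ((sqrt 3 - 1) * (sqrt 3 + 1)) * ((sqrt 5 - sqrt 3) * (sqrt 5 + sqrt 3)) / 4"
      by (simp add: u_def)
    also have "\<dots> = sqrt 3"
      unfolding prods by simp
    finally show ?thesis using u(2) by (simp add: field_simps)
  qed
  \<comment> \<open>Likewise for the five evaluations at arguments with \<open>sqrt 3\<close>:
    inversion and this constant suffice.\<close>
  define c where "c = root 3 4 - (1::real)"
  have c: "3 * psiF (3 * sqrt 3) = c * psiF (1 / sqrt 3)" "c > 0"
  proof -
    show "3 * psiF (3 * sqrt 3) = c * psiF (1 / sqrt 3)"
      using psiF_sqrt_3 pos by (simp add: c_def field_simps)
    thus "c > 0" using pos by (metis mult_pos_pos zero_less_mult_pos2 zero_less_numeral)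
  qed
  \<comment> \<open>The three evaluations at rational arguments need only \<open>h\<close> and
    inversion at 3.\<close>
  define h where "h = psiF 1 / psiF 3"
  have h: "h > 0" "h ^ 4 = 3 * sqrt 3 * (2 + sqrt 3)"
    using psiF_1_3 pos by (simp_all add: h_def)

  have 1: "psi (- exp (- pi / sqrt 5)) / (exp (- pi / (2 * sqrt 5)) * psi (- exp (- sqrt 5 * pi))) = root 4 5"
  proof -
    have "psi (- exp (- pi / sqrt 5)) / (exp (- pi / (2 * sqrt 5)) * psi (- exp (- sqrt 5 * pi))) = psiF (1 / sqrt 5) / psiF (sqrt 5)"
      by (rule psi_ratio[where e = "1 / (2 * sqrt 5)"]) (simp_all add: field_simps)
    thus ?thesis unfolding inv5 using pos by simp
  qed
  have 2: "psi (- exp (- 3 * pi / sqrt 5)) / (exp (- 3 * pi / (2 * sqrt 5)) * psi (- exp (- 3 * sqrt 5 * pi)))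
     = root 4 5 * (sqrt 3 + 1) * (sqrt 5 + sqrt 3) / 2"
  proof -
    have "psi (- exp (- 3 * pi / sqrt 5)) / (exp (- 3 * pi / (2 * sqrt 5)) * psi (- exp (- 3 * sqrt 5 * pi)))
       = psiF (1 / (sqrt 5 / 3)) / psiF (3 * sqrt 5)"
      by (rule psi_ratio[where e = "3 / (2 * sqrt 5)"]) (simp_all add: field_simps)
    also have "\<dots> = root 4 5 / sqrt 3 * u"
      unfolding inv5 u(1) using pos by simp
    finally show ?thesis by (simp add: u_def)
  qed
  have 3: "psi (- exp (- pi / (3 * sqrt 5))) / (exp (- pi / (3 * sqrt 5)) * psi (- exp (- 3 * pi / sqrt 5)))
     = sqrt 3 * (sqrt 3 - 1) * (sqrt 5 - sqrt 3) / 2"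
  proof -
    have "psi (- exp (- pi / (3 * sqrt 5))) / (exp (- pi / (3 * sqrt 5)) * psi (- exp (- 3 * pi / sqrt 5)))
       = psiF (1 / (3 * sqrt 5)) / psiF (1 / (sqrt 5 / 3))"
      by (rule psi_ratio[where e = "1 / (3 * sqrt 5)"]) (simp_all add: field_simps)
    also have "\<dots> = sqrt 3 * (sqrt 3 / u)"
      unfolding inv5 u(1) using pos u(2) by (simp add: field_simps)
    finally show ?thesis unfolding u_inv by simp
  qed
  have 6: "psi (- exp (- pi / (3 * sqrt 5))) / (exp (- pi / (6 * sqrt 5)) * psi (- exp (- sqrt 5 * pi / 3)))
     = root 4 5 * (sqrt 3 - 1) * (sqrt 5 - sqrt 3) / 2"
  proof -
    have "psi (- exp (- pi / (3 * sqrt 5))) / (exp (- pi / (6 * sqrt 5)) * psi (- exp (- sqrt 5 * pi / 3)))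
       = psiF (1 / (3 * sqrt 5)) / psiF (sqrt 5 / 3)"
      by (rule psi_ratio[where e = "1 / (6 * sqrt 5)"]) (simp_all add: field_simps)
    also have "\<dots> = root 4 5 * (sqrt 3 / u)"
      unfolding inv5 u(1) using pos u(2) by (simp add: field_simps)
    finally show ?thesis unfolding u_inv by simp
  qed
  have 7: "psi (- exp (- sqrt 5 * pi / 3)) / (exp (- sqrt 5 * pi / 3) * psi (- exp (- 3 * sqrt 5 * pi)))
     = sqrt 3 * (sqrt 3 + 1) * (sqrt 5 + sqrt 3) / 2"
  proof -
    have "psi (- exp (- sqrt 5 * pi / 3)) / (exp (- sqrt 5 * pi / 3) * psi (- exp (- 3 * sqrt 5 * pi)))
       = psiF (sqrt 5 / 3) / psiF (3 * sqrt 5)"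
      by (rule psi_ratio[where e = "sqrt 5 / 3"]) (simp_all add: field_simps)
    thus ?thesis unfolding psiF_sqrt_5 .
  qed
  have 4: "psi (- exp (- pi / (3 * sqrt 3))) / (exp (- pi / (12 * sqrt 3)) * psi (- exp (- pi / sqrt 3)))
     = 3 powr (- 1 / 4) * (root 3 4 - 1)"
  proof -
    have "psi (- exp (- pi / (3 * sqrt 3))) / (exp (- pi / (12 * sqrt 3)) * psi (- exp (- pi / sqrt 3)))
       = psiF (1 / (3 * sqrt 3)) / psiF (1 / sqrt 3)"
      by (rule psi_ratio[where e = "1 / (12 * sqrt 3)"]) (simp_all add: field_simps)
    also have "\<dots> = root 4 27 / 3 * (3 * psiF (3 * sqrt 3)) / psiF (1 / sqrt 3)"
      unfolding inv3(2) by simp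
    also have "\<dots> = root 4 27 / 3 * c"
      unfolding c(1) using pos by simp
    also have "root 4 27 / 3 = 1 / root 4 (3::real)"
      using root3' by (simp add: field_simps)
    also have "1 / root 4 3 = 3 powr (- 1 / 4)"
      by (simp add: root_powr_inverse powr_minus_divide)
    finally show ?thesis by (simp add: c_def)
  qed
  have 8: "psi (- exp (- pi / sqrt 3)) / (exp (- pi / (4 * sqrt 3)) * psi (- exp (- sqrt 3 * pi))) = root 4 3"
  proof -
    have "psi (- exp (- pi / sqrt 3)) / (exp (- pi / (4 * sqrt 3)) * psi (- exp (- sqrt 3 * pi))) = psiF (1 / sqrt 3) / psiF (sqrt 3)"
      by (rule psi_ratio[where e = "1 / (4 * sqrt 3)"]) (simp_all add: field_simps)
    thus ?thesis unfolding inv3 using pos by simp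
  qed
  have 9: "psi (- exp (- sqrt 3 * pi)) / (exp (- sqrt 3 * pi / 4) * psi (- exp (- 3 * sqrt 3 * pi)))
     = root 4 27 / (root 3 4 - 1)"
  proof -
    have "psi (- exp (- sqrt 3 * pi)) / (exp (- sqrt 3 * pi / 4) * psi (- exp (- 3 * sqrt 3 * pi)))
       = psiF (sqrt 3) / psiF (3 * sqrt 3)"
      by (rule psi_ratio[where e = "sqrt 3 / 4"]) (simp_all add: field_simps)
    also have "\<dots> = 3 * psiF (sqrt 3) / (3 * psiF (3 * sqrt 3))"
      by simp
    also have "\<dots> = 3 / (c * root 4 3)"
      unfolding c(1) inv3(1) using pos by simp
    also have "\<dots> = root 4 27 / c"
      using root3' c(2) by (simp add: field_simps)
    finally show ?thesis by (simp add: c_def)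
  qed
  have 12: "psi (- exp (- pi / sqrt 3)) / (exp (- pi / sqrt 3) * psi (- exp (- 3 * sqrt 3 * pi)))
     = 3 / (root 3 4 - 1)"
  proof -
    have "psi (- exp (- pi / sqrt 3)) / (exp (- pi / sqrt 3) * psi (- exp (- 3 * sqrt 3 * pi)))
       = psiF (1 / sqrt 3) / psiF (3 * sqrt 3)"
      by (rule psi_ratio[where e = "1 / sqrt 3"]) (simp_all add: field_simps)
    also have "\<dots> = 3 * psiF (1 / sqrt 3) / (3 * psiF (3 * sqrt 3))"
      by simp
    also have "\<dots> = 3 / c"
      unfolding c(1) using pos by simp
    finally show ?thesis by (simp add: c_def)
  qed
  have 13: "psi (- exp (- pi / (3 * sqrt 3))) / (exp (- pi / (3 * sqrt 3)) * psi (- exp (- sqrt 3 * pi)))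
     = root 3 4 - 1"
  proof -
    have "psi (- exp (- pi / (3 * sqrt 3))) / (exp (- pi / (3 * sqrt 3)) * psi (- exp (- sqrt 3 * pi)))
       = psiF (1 / (3 * sqrt 3)) / psiF (sqrt 3)"
      by (rule psi_ratio[where e = "1 / (3 * sqrt 3)"]) (simp_all add: field_simps)
    also have "\<dots> = root 4 27 / 3 * (3 * psiF (3 * sqrt 3)) / psiF (sqrt 3)"
      unfolding inv3(2) by simp
    also have "\<dots> = (root 4 3 * root 4 27) / 3 * c"
      unfolding c(1) inv3(1) using pos by simp
    finally show ?thesis unfolding root3' by (simp add: c_def)
  qed
  have 5: "psi (- exp (- pi)) / (exp (- pi / 4) * psi (- exp (- 3 * pi))) = root 4 (3 * sqrt 3 * (2 + sqrt 3))"
  proof -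
    have "psi (- exp (- pi)) / (exp (- pi / 4) * psi (- exp (- 3 * pi))) = psiF 1 / psiF 3"
      by (rule psi_ratio[where e = "1 / 4"]) simp_all
    also have "\<dots> = root 4 (h ^ 4)"
      using h(1) by (simp add: h_def real_root_power_cancel)
    finally show ?thesis unfolding h .
  qed
  have 10: "psi (- exp (- pi / 3)) / (exp (- pi / 3) * psi (- exp (- 3 * pi))) = sqrt 3"
  proof -
    have "psi (- exp (- pi / 3)) / (exp (- pi / 3) * psi (- exp (- 3 * pi))) = psiF (1 / 3) / psiF 3"
      by (rule psi_ratio[where e = "1 / 3"]) simp_all
    thus ?thesis unfolding inv1 using pos by simp
  qed
  have 11: "psi (- exp (- pi / 3)) / (exp (- pi / 12) * psi (- exp (- pi))) = root 4 (sqrt 3 * (2 - sqrt 3))"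
  proof -
    have "psi (- exp (- pi / 3)) / (exp (- pi / 12) * psi (- exp (- pi))) = psiF (1 / 3) / psiF 1"
      by (rule psi_ratio[where e = "1 / 12"]) simp_all
    also have "\<dots> = sqrt 3 / h"
      unfolding inv1 h_def by simp
    also have "\<dots> = root 4 ((sqrt 3 / h) ^ 4)"
      using h(1) by (simp add: real_root_power_cancel)
    also have "(sqrt 3 / h) ^ 4 = sqrt 3 * (2 - sqrt 3)"
    proof -
      have p4: "sqrt 3 ^ 4 = (9::real)"
        by (simp add: power4_eq_xxxx)
      \<comment> \<open>Here \<open>2 - sqrt 3\<close> and \<open>2 + sqrt 3\<close> are reciprocal,
        so dividing 9 by \<open>h ^ 4\<close> yields the conjugate expression.\<close>
      have "(9::real) = sqrt 3 * (2 - sqrt 3) * (3 * sqrt 3 * (2 + sqrt 3))"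
        using s(1) by (simp add: algebra_simps)
      moreover have "3 * sqrt 3 * (2 + sqrt 3) > (0::real)"
        by (simp add: add_pos_pos)
      ultimately show ?thesis
        unfolding power_divide h(2) p4 by (metis less_irrefl nonzero_mult_div_cancel_right)
    qed
    finally show ?thesis .
  qed
  show ?thesis
    using 1 2 3 4 5 6 7 8 9 10 11 12 13 by blast
qed

end
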